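(* Let $p>3$ be a prime and $b\in\mathbb{Z}_p$. A $3$-coloring $\mathbb{Z}_p=A\cup B\cup C$ with $1\leq |A|\leq |B|\leq |C|$ is rainbow-free with respect to the equation $x+y+z=b$ if and only if one of the following holds: (i) $A=\{s\}$ for some $s\in\mathbb{Z}_p$, and both $(B\setminus\{b-2s\})+(s-b)2^{-1}$ and $(C\setminus\{b-2s\})+(s-b)2^{-1}$ are symmetric sets; (ii) $|A|\geq 2$ and $A$, $B$, $C$ are all arithmetic progressions with the same common difference $d\in\mathbb{Z}_p\setminus\{0\}$, so that $d^{-1}A=\{i\}_{i=t_1}^{t_2-1}$, $d^{-1}B=\{i\}_{i=t_2}^{t_3-1}$ and $d^{-1}C=\{i\}_{i=t_3}^{t_1-1}$ for some $t_1,t_2,t_3\in\mathbb{Z}_p$ satisfying $t_1+t_2+t_3\in\{1+d^{-1}b,\,2+d^{-1}b\}$.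
   Context: A $3$-coloring of $\mathbb{Z}_p$ is a partition $\mathbb{Z}_p=A\cup B\cup C$ into three nonempty color classes. A set $\{s_1,s_2,s_3\}\subseteq\mathbb{Z}_p$ is a solution of $x+y+z=b$ if $s_1+s_2+s_3=b$. A solution is rainbow if its elements belong pairwise to distinct color classes; a $3$-coloring is rainbow-free with respect to an equation if it contains no rainbow solution of it. For $S\subseteq\mathbb{Z}_p$ and $t,d\in\mathbb{Z}_p$, $S+t=\{x+t:x\in S\}$ and $dS=\{dx:x\in S\}$. A set $S\subseteq\mathbb{Z}_p$ is symmetric if $S=-S$. For $t,u\in\mathbb{Z}_p$, $\{i\}_{i=t}^{u-1}$ denotes the cyclic interval $\{t,t+1,\dots,u-1\}$ in $\mathbb{Z}_p$. *)

theory Defs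
  imports "Berlekamp_Zassenhaus.Finite_Field"
begin

text \<open>
  The field of residues modulo a prime \<open>p\<close> is \<open>'p mod_ring\<close> for a type variable
  \<open>'p\<close> of class \<open>prime_card\<close>, that is, \<open>p = CARD('p)\<close> is prime.
\<close>

definition three_coloring ::
    "'p mod_ring set \<Rightarrow> 'p mod_ring set \<Rightarrow> 'p::prime_card mod_ring set \<Rightarrow> bool" where
  "three_coloring A B C \<longleftrightarrow>
     A \<union> B \<union> C = UNIV \<and> A \<inter> B = {} \<and> A \<inter> C = {} \<and> B \<inter> C = {} \<and>
     A \<noteq> {} \<and> B \<noteq> {} \<and> C \<noteq> {}"

definition same_color ::
    "'p mod_ring set \<Rightarrow> 'p mod_ring set \<Rightarrow> 'p::prime_card mod_ring set \<Rightarrow>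
     'p mod_ring \<Rightarrow> 'p mod_ring \<Rightarrow> bool" where
  "same_color A B C x y \<longleftrightarrow> (\<exists>K\<in>{A, B, C}. x \<in> K \<and> y \<in> K)"

text \<open>
  A solution is given by its three entries, so that a solution with a repeated entry
  has two entries of the same color and is never rainbow.
\<close>

definition rainbow_solution ::
    "'p mod_ring set \<Rightarrow> 'p mod_ring set \<Rightarrow> 'p::prime_card mod_ring set \<Rightarrow> 'p mod_ring \<Rightarrow>
     'p mod_ring \<Rightarrow> 'p mod_ring \<Rightarrow> 'p mod_ring \<Rightarrow> bool" where
  "rainbow_solution A B C b s1 s2 s3 \<longleftrightarrow>
     s1 + s2 + s3 = b \<and>
     \<not> same_color A B C s1 s2 \<and> \<not> same_color A B C s1 s3 \<and> \<not> same_color A B C s2 s3"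

definition rainbow_free ::
    "'p mod_ring set \<Rightarrow> 'p mod_ring set \<Rightarrow> 'p::prime_card mod_ring set \<Rightarrow> 'p mod_ring \<Rightarrow> bool" where
  "rainbow_free A B C b \<longleftrightarrow> \<not> (\<exists>s1 s2 s3. rainbow_solution A B C b s1 s2 s3)"

definition translate :: "'p::prime_card mod_ring set \<Rightarrow> 'p mod_ring \<Rightarrow> 'p mod_ring set" where
  "translate S t = (\<lambda>x. x + t) ` S"

definition dilate :: "'p::prime_card mod_ring \<Rightarrow> 'p mod_ring set \<Rightarrow> 'p mod_ring set" where
  "dilate d S = (\<lambda>x. d * x) ` S"

definition symmetric_set :: "'p::prime_card mod_ring set \<Rightarrow> bool" where
  "symmetric_set S \<longleftrightarrow> S = uminus ` S"

definition arith_progression :: "'p::prime_card mod_ring \<Rightarrow> 'p mod_ring set \<Rightarrow> bool" where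
  "arith_progression d S \<longleftrightarrow> (\<exists>a k. S = (\<lambda>i. a + of_nat i * d) ` {..<k})"

text \<open>
  The cyclic interval \<open>{t, t + 1, \<dots>, u - 1}\<close>: its length is the representative of
  \<open>u - t\<close> in \<open>{0..<p}\<close>, so it is empty for \<open>t = u\<close>.
\<close>

definition cyclic_interval :: "'p::prime_card mod_ring \<Rightarrow> 'p mod_ring \<Rightarrow> 'p mod_ring set" where
  "cyclic_interval t u = (\<lambda>i. t + of_nat i) ` {..<nat (to_int_mod_ring (u - t))}"

end

(* Call a maximal progression of difference d inside a color class a d-block.  If X is a class,
   r and r - d lie in X, and a step of length d leads from q in one of the other two classes Y, Z
   to the other one, then b - q - r lies in X again: otherwise (r, q, b - q - r) or
   (r - d, q + d, b - q - r) is rainbow.  Hence the reflections of the slightly eroded set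
   X Int (X + d) at the boundaries between Y and Z all fit into X.  If X is a single d-block, this
   leaves at most two adjacent boundaries between Y and Z, and counting the steps between the
   classes shows that each class is a single d-block; the three blocks then sum to an interval
   of length p - 2, which has to miss b.

   It remains to see that some class is a progression.  Let B be the class of middle size.  The
   sumset of B with another class has at most |A| + |B| elements, and a minimal fragment S of B
   (as in Hamidoune's isoperimetric method) is a Sidon set, so it has at most three elements, and
   exactly three only if the complement of B has at most six elements.  If S = {s, s + d}, then B
   has at most two d-blocks.  If B has exactly two, at least four elements, and is not a
   progression, the reflections force the boundaries between the two other classes to be two
   adjacent points, and doing this for two classes at once is impossible.  The only sizes not
   covered are (3, 3, p - 6); there the second class is a translate of the first class A, and
   comparing A + A with two translates of - A leads to a contradiction. *)

theory Submission
  imports Defs "HOL-Number_Theory.Cong"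
begin

section \<open>Translates and progressions modulo a prime\<close>

lemma of_nat_mod_ring_eq_iff:
  "(of_nat m :: 'p::prime_card mod_ring) = of_nat n \<longleftrightarrow> m mod CARD('p) = n mod CARD('p)"
proof -
  have "(of_nat m :: 'p mod_ring) = of_nat n \<longleftrightarrow> [m = n] (mod CHAR('p mod_ring))"
    by (rule of_nat_eq_iff_cong_CHAR)
  then show ?thesis by (simp add: cong_def)
qed

lemma of_nat_mod_ring_inj:
  assumes "(of_nat m :: 'p::prime_card mod_ring) = of_nat n" "m < CARD('p)" "n < CARD('p)"
  shows "m = n"
  using assms by (simp add: of_nat_mod_ring_eq_iff)

lemma of_nat_mod_ring_neq_0:
  assumes "0 < n" "n < CARD('p)"
  shows "(of_nat n :: 'p::prime_card mod_ring) \<noteq> 0"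
  using assms of_nat_mod_ring_inj[of n 0] by auto

lemma of_nat_mult_cancel:
  fixes d :: "'p::prime_card mod_ring"
  assumes "of_nat m * d = of_nat n * d" "d \<noteq> 0" "m < CARD('p)" "n < CARD('p)"
  shows "m = n"
  using assms of_nat_mod_ring_inj by auto

lemma mod_ring_multiple:
  fixes d z :: "'p::prime_card mod_ring"
  assumes "d \<noteq> 0"
  obtains n where "n < CARD('p)" "z = of_nat n * d"
proof -
  obtain n where "n < CARD('p)" "z / d = of_nat n"
    using surj_of_nat_mod_ring by blast
  with assms that show thesis by (metis nonzero_eq_divide_eq)
qed

text \<open>The multiples of a nonzero \<open>d\<close> exhaust the field because p is
  prime.\<close>

lemma shift_closed_UNIV:
  fixes d :: "'p::prime_card mod_ring"
  assumes "\<And>x. x \<in> V \<Longrightarrow> x + d \<in> V" "d \<noteq> 0" "V \<noteq> {}"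
  shows "V = UNIV"
proof -
  obtain v where v: "v \<in> V" using assms(3) by auto
  have it: "v + of_nat n * d \<in> V" for n
  proof (induction n)
    case (Suc n)
    then show ?case using assms(1)[OF Suc.IH] by (simp add: algebra_simps)
  qed (use v in simp)
  have "z \<in> V" for z
  proof -
    obtain n where "z - v = of_nat n * d" using mod_ring_multiple[OF assms(2)] by blast
    then show ?thesis using it[of n] by (simp add: algebra_simps)
  qed
  then show ?thesis by auto
qed

lemma mem_translate [simp]: "x \<in> translate S t \<longleftrightarrow> x - t \<in> S"
  unfolding translate_def by (auto simp: image_iff intro!: bexI[of _ "x - t"])

lemma card_translate [simp]: "card (translate S t) = card S"
  unfolding translate_def by (rule card_image) (auto simp: inj_on_def)

lemma translate_eq_UNIV:
  fixes d :: "'p::prime_card mod_ring"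
  assumes "translate V d = V" "d \<noteq> 0" "V \<noteq> {}"
  shows "V = UNIV"
proof (rule shift_closed_UNIV)
  show "x + d \<in> V" if "x \<in> V" for x
    using that mem_translate[of "x + d" V d] assms(1) by simp
qed (use assms in auto)

section \<open>Progressions, steps and maximal blocks of a fixed difference\<close>

definition ap :: "'p::prime_card mod_ring \<Rightarrow> 'p mod_ring \<Rightarrow> nat \<Rightarrow> 'p mod_ring set" where
  "ap d x m = (\<lambda>i. x + of_nat i * d) ` {..<m}"

definition is_ap :: "'p::prime_card mod_ring set \<Rightarrow> bool" where
  "is_ap X \<longleftrightarrow> (\<exists>d x m. d \<noteq> 0 \<and> X = ap d x m)"

text \<open>For \<open>d \<noteq> 0\<close> and \<open>X \<noteq> UNIV\<close>, the number of maximal \<open>d\<close>-progressions in \<open>X\<close> is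
  \<open>card (steps d (- X) X)\<close>.\<close>

definition steps :: "'p::prime_card mod_ring \<Rightarrow> 'p mod_ring set \<Rightarrow> 'p mod_ring set \<Rightarrow> 'p mod_ring set"
  where "steps d X Y = {x \<in> X. x + d \<in> Y}"

lemma mem_steps [simp]: "x \<in> steps d X Y \<longleftrightarrow> x \<in> X \<and> x + d \<in> Y"
  by (simp add: steps_def)

lemma ap_I: "i < m \<Longrightarrow> x + of_nat i * d \<in> ap d x m"
  by (auto simp: ap_def)

lemma ap_start: "0 < m \<Longrightarrow> x \<in> ap d x m"
  using ap_I[of 0 m x d] by simp

lemma card_ap:
  fixes d :: "'p::prime_card mod_ring"
  assumes "d \<noteq> 0" "m \<le> CARD('p)"
  shows "card (ap d x m) = m"
proof -
  have "inj_on (\<lambda>i. x + of_nat i * d) {..<m}"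
  proof (rule inj_onI)
    fix i j assume "i \<in> {..<m}" "j \<in> {..<m}" "x + of_nat i * d = x + of_nat j * d"
    then show "i = j" using of_nat_mult_cancel[of i d j] assms by auto
  qed
  then show ?thesis by (simp add: ap_def card_image)
qed

lemma ap_end_notin:
  fixes d :: "'p::prime_card mod_ring"
  assumes "d \<noteq> 0" "m < CARD('p)"
  shows "x + of_nat m * d \<notin> ap d x m"
proof
  assume "x + of_nat m * d \<in> ap d x m"
  then obtain i where "i < m" "of_nat m * d = of_nat i * d" by (auto simp: ap_def)
  then show False using of_nat_mult_cancel[of m d i] assms by auto
qed

text \<open>The two progressions supply the even and the odd multiples of \<open>h\<close>. This is
  how a set with two blocks can be a progression in disguise.\<close>

lemma ap_interleave:
  assumes "m = l \<or> m = Suc l"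
  shows "ap (2 * h) x m \<union> ap (2 * h) (x + h) l = ap h x (m + l)"
proof (intro equalityI subsetI)
  fix z assume "z \<in> ap (2 * h) x m \<union> ap (2 * h) (x + h) l"
  then show "z \<in> ap h x (m + l)"
  proof
    assume "z \<in> ap (2 * h) x m"
    then obtain i where "i < m" "z = x + of_nat i * (2 * h)" by (auto simp: ap_def)
    then show ?thesis using ap_I[of "2 * i" "m + l" x h] assms by (auto simp: algebra_simps)
  next
    assume "z \<in> ap (2 * h) (x + h) l"
    then obtain i where "i < l" "z = x + h + of_nat i * (2 * h)" by (auto simp: ap_def)
    then show ?thesis using ap_I[of "2 * i + 1" "m + l" x h] assms by (auto simp: algebra_simps)
  qed
next
  fix z assume "z \<in> ap h x (m + l)"
  then obtain i where i: "i < m + l" "z = x + of_nat i * h" by (auto simp: ap_def)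
  show "z \<in> ap (2 * h) x m \<union> ap (2 * h) (x + h) l"
  proof (cases "even i")
    case True
    then obtain j where "i = 2 * j" by (elim evenE)
    then show ?thesis using ap_I[of j m x "2 * h"] i assms by (auto simp: algebra_simps)
  next
    case False
    then obtain j where "i = 2 * j + 1" by (elim oddE)
    then show ?thesis using ap_I[of j l "x + h" "2 * h"] i assms by (auto simp: algebra_simps)
  qed
qed

text \<open>A progression inside \<open>X\<close> that starts in the block cannot cross the point
  just past the block's end, which lies outside \<open>X\<close>.\<close>

lemma ap_subset_component:
  assumes "ap d f n \<subseteq> X" "f \<in> ap d x m" "x + of_nat m * d \<notin> X" "0 < n"
  obtains j where "j + n \<le> m" "f = x + of_nat j * d"
proof -
  obtain j where j: "j < m" "f = x + of_nat j * d" using assms(2) by (auto simp: ap_def)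
  have "i < n \<Longrightarrow> j + i < m" for i
  proof (induction i)
    case (Suc i)
    then have "j + i < m" by simp
    moreover have "j + Suc i \<noteq> m"
    proof
      assume eq: "j + Suc i = m"
      have "f + of_nat (Suc i) * d \<in> X" using Suc.prems assms(1) ap_I by blast
      moreover have "f + of_nat (Suc i) * d = x + of_nat m * d"
        unfolding j(2) eq[symmetric] by (simp add: algebra_simps)
      ultimately show False using assms(3) by simp
    qed
    ultimately show ?case by simp
  qed (use j in simp)
  from this[of "n - 1"] assms(4) have "j + n \<le> m" by auto
  then show thesis using that j by blast
qed

lemma no_steps_trivial:
  fixes d :: "'p::prime_card mod_ring"
  assumes "steps d X (- X) = {}" "d \<noteq> 0"
  shows "X = {} \<or> X = UNIV"
  using shift_closed_UNIV[of X d] assms by (auto simp: steps_def)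

lemma card_steps_split:
  fixes d :: "'p::prime_card mod_ring"
  assumes "Y \<inter> Z = {}"
  shows "card (steps d X (Y \<union> Z)) = card (steps d X Y) + card (steps d X Z)"
    and "card (steps d (Y \<union> Z) X) = card (steps d Y X) + card (steps d Z X)"
proof -
  have "steps d X (Y \<union> Z) = steps d X Y \<union> steps d X Z" "steps d X Y \<inter> steps d X Z = {}"
    "steps d (Y \<union> Z) X = steps d Y X \<union> steps d Z X" "steps d Y X \<inter> steps d Z X = {}"
    using assms by auto
  then show "card (steps d X (Y \<union> Z)) = card (steps d X Y) + card (steps d X Z)"
    "card (steps d (Y \<union> Z) X) = card (steps d Y X) + card (steps d Z X)"
    by (simp_all add: card_Un_disjoint)
qed

text \<open>Entries balance exits: the steps out of points of \<open>X\<close> and the steps into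
  points of \<open>X\<close> both number \<open>card X\<close>, and the steps inside
  \<open>X\<close> are counted in both.\<close>

lemma card_steps_compl:
  fixes d :: "'p::prime_card mod_ring"
  shows "card (steps d X (- X)) = card (steps d (- X) X)"
proof -
  have "steps d X UNIV = X" by auto
  moreover have "translate (steps d UNIV X) d = X" by (auto)
  then have "card (steps d UNIV X) = card X" using card_translate by metis
  ultimately have "card (steps d X (X \<union> - X)) = card (steps d (X \<union> - X) X)"
    by (simp del: card_translate)
  then show ?thesis by (simp only: card_steps_split Compl_disjoint)
qed

text \<open>Deleting the block that begins at \<open>s\<close> destroys only the entry step at
  \<open>s - d\<close>, so blocks can be removed one at a time.\<close>

lemma extract_component:
  fixes d :: "'p::prime_card mod_ring"
  assumes "s \<in> X" "s - d \<notin> X" "d \<noteq> 0"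
  obtains m where "0 < m" "m < CARD('p)" "ap d s m \<subseteq> X" "s + of_nat m * d \<notin> X"
    "steps d (- (X - ap d s m)) (X - ap d s m) = steps d (- X) X - {s - d}"
proof -
  \<comment> \<open>The point \<open>s - d\<close> outside \<open>X\<close> is reached from
    \<open>s\<close> after \<open>n\<close> steps, which bounds the length of the block by
    \<open>n < p\<close>.\<close>
  obtain n where n: "n < CARD('p)" "- d = of_nat n * d" using mod_ring_multiple[OF assms(3)] by blast
  define m where "m = (LEAST m. s + of_nat m * d \<notin> X)"
  have ex: "s + of_nat n * d \<notin> X" using n assms(2) by (metis add_uminus_conv_diff)
  have m: "s + of_nat m * d \<notin> X" unfolding m_def by (rule LeastI) (rule ex)
  have lt: "i < m \<Longrightarrow> s + of_nat i * d \<in> X" for i using not_less_Least unfolding m_def by blast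
  have "m \<le> n" unfolding m_def by (rule Least_le) (rule ex)
  then have mp: "m < CARD('p)" using n by simp
  have m0: "0 < m" using m assms(1) by (cases m) auto
  have sub: "ap d s m \<subseteq> X" using lt by (auto simp: ap_def)
  have "steps d (- (X - ap d s m)) (X - ap d s m) = steps d (- X) X - {s - d}" (is "?L = ?R")
  proof (intro equalityI subsetI)
    fix y assume y: "y \<in> ?L"
    have "y \<notin> ap d s m"
    proof
      assume "y \<in> ap d s m"
      then obtain i where i: "i < m" "y = s + of_nat i * d" by (auto simp: ap_def)
      then have eq: "y + d = s + of_nat (Suc i) * d" by (simp add: algebra_simps)
      have "y + d \<in> X" using y by simp
      then have "Suc i \<noteq> m" using m eq by metis
      then have "y + d \<in> ap d s m" unfolding eq using i by (intro ap_I) simp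
      then show False using y by simp
    qed
    then show "y \<in> ?R" using y ap_start[OF m0, of s d] by auto
  next
    fix y assume y: "y \<in> ?R"
    have "y + d \<notin> ap d s m"
    proof
      assume "y + d \<in> ap d s m"
      then obtain i where i: "i < m" "y + d = s + of_nat i * d" by (auto simp: ap_def)
      show False
      proof (cases i)
        case 0 then show ?thesis using i y by (auto simp: eq_diff_eq)
      next
        case (Suc k)
        then have "y = s + of_nat k * d" using i by (simp add: algebra_simps)
        then show False using lt[of k] Suc i y by auto
      qed
    qed
    then show "y \<in> ?L" using y by auto
  qed
  then show thesis using that m0 mp sub m by blast
qed

lemma one_component:
  fixes d :: "'p::prime_card mod_ring"
  assumes "card (steps d (- X) X) = 1" "d \<noteq> 0"
  obtains s m where "0 < m" "m < CARD('p)" "X = ap d s m" "steps d (- X) X = {s - d}"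
proof -
  obtain y where y: "steps d (- X) X = {y}" using assms(1) by (auto simp: card_1_singleton_iff)
  define s where "s = y + d"
  have s: "s \<in> X" "s - d \<notin> X" using y by (auto simp: s_def set_eq_iff)
  obtain m where m: "0 < m" "m < CARD('p)" "ap d s m \<subseteq> X" "s + of_nat m * d \<notin> X"
    "steps d (- (X - ap d s m)) (X - ap d s m) = steps d (- X) X - {s - d}"
    using extract_component[OF s assms(2)] by blast
  \<comment> \<open>No step leaves what remains after deleting the block, so it is empty; it is not
    everything because it lacks \<open>s\<close>.\<close>
  have "card (steps d (X - ap d s m) (- (X - ap d s m))) = 0"
    unfolding card_steps_compl m(5) using y by (simp add: s_def)
  then have "steps d (X - ap d s m) (- (X - ap d s m)) = {}" by (meson card_0_eq finite)
  then have "X - ap d s m = {} \<or> X - ap d s m = UNIV" by (rule no_steps_trivial) (rule assms(2))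
  then have "X = ap d s m" using m(3) ap_start[OF m(1), of s d] by blast
  moreover have "steps d (- X) X = {s - d}" using y by (simp add: s_def)
  ultimately show thesis using that[OF m(1,2)] by blast
qed

lemma is_ap_one_component:
  fixes d :: "'p::prime_card mod_ring"
  assumes "card (steps d (- X) X) = 1" "d \<noteq> 0"
  shows "is_ap X"
proof -
  obtain s m where "X = ap d s m" using one_component[OF assms] by blast
  then show ?thesis using assms(2) unfolding is_ap_def by blast
qed

lemma two_components:
  fixes d :: "'p::prime_card mod_ring"
  assumes "card (steps d (- X) X) = 2" "d \<noteq> 0"
  obtains x m y l where "0 < m" "0 < l" "m < CARD('p)" "l < CARD('p)"
    "X = ap d x m \<union> ap d y l" "ap d x m \<inter> ap d y l = {}"
    "x - d \<notin> X" "y - d \<notin> X" "x + of_nat m * d \<notin> X" "y + of_nat l * d \<notin> X"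
proof -
  obtain u v where uv: "steps d (- X) X = {u, v}" "u \<noteq> v" using assms(1) by (auto simp: card_2_iff)
  define x where "x = u + d"
  have x: "x \<in> X" "x - d \<notin> X" using uv by (auto simp: x_def set_eq_iff)
  obtain m where m: "0 < m" "m < CARD('p)" "ap d x m \<subseteq> X" "x + of_nat m * d \<notin> X"
    "steps d (- (X - ap d x m)) (X - ap d x m) = steps d (- X) X - {x - d}"
    using extract_component[OF x assms(2)] by blast
  define X' where "X' = X - ap d x m"
  have st: "steps d (- X') X' = {v}" using m(5) uv by (auto simp: X'_def x_def)
  then obtain y l where y: "0 < l" "l < CARD('p)" "X' = ap d y l" "steps d (- X') X' = {y - d}"
  proof -
    have "card (steps d (- X') X') = 1" using st by simp
    then show thesis by (rule one_component[OF _ assms(2)]) (rule that)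
  qed
  have v: "v = y - d" using st y(4) by simp
  have yX: "y - d \<notin> X" using uv(1) v by (auto simp: set_eq_iff)
  \<comment> \<open>The second block might run into the first. It would do so at \<open>x\<close>,
    whose predecessor is outside \<open>X\<close>, or further inside, where the predecessor belongs
    to the first block.\<close>
  have yl: "y + of_nat l * d \<notin> X"
  proof
    assume "y + of_nat l * d \<in> X"
    moreover have "y + of_nat l * d \<notin> X'" unfolding y(3) by (rule ap_end_notin[OF assms(2) y(2)])
    ultimately obtain i where i: "i < m" "y + of_nat l * d = x + of_nat i * d"
      unfolding X'_def by (auto simp: ap_def)
    have last: "y + of_nat (l - 1) * d \<in> X'" unfolding y(3) using y(1) by (intro ap_I) auto
    have eq: "y + of_nat (l - 1) * d = x + of_nat i * d - d"
      using i(2) y(1) by (simp add: algebra_simps of_nat_diff)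
    show False
    proof (cases i)
      case 0
      then show False using last eq x(2) unfolding X'_def by simp
    next
      case (Suc k)
      then have "y + of_nat (l - 1) * d \<in> ap d x m" using eq i(1) ap_I[of k m x d] by (simp add: algebra_simps)
      then show False using last unfolding X'_def by simp
    qed
  qed
  show thesis
    by (rule that[OF m(1) y(1) m(2) y(2) _ _ x(2) yX m(4) yl]) (use m(3) y(3) X'_def in auto)
qed

text \<open>A point of \<open>V\<close> reached from outside is followed by a point outside
  \<open>V\<close>. So two consecutive points of \<open>V\<close> need a predecessor in
  \<open>V\<close>, and so on backwards around the whole cycle. Hence every point of
  \<open>V\<close> is an entry point.\<close>

lemma card_isolated:
  fixes d :: "'p::prime_card mod_ring"
  assumes "V \<noteq> UNIV" "d \<noteq> 0" "\<And>v. v \<notin> V \<Longrightarrow> v + d \<in> V \<Longrightarrow> v + d + d \<notin> V"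
  shows "card V = card (steps d (- V) V)"
proof -
  have iso: "v - d \<notin> V" if v: "v \<in> V" for v
  proof
    assume vd: "v - d \<in> V"
    define W where "W = {w \<in> V. w + d \<in> V}"
    have "W = UNIV"
    proof (rule shift_closed_UNIV[of W "- d"])
      fix w assume "w \<in> W"
      then have w: "w \<in> V" "w + d \<in> V" by (simp_all add: W_def)
      have "w - d \<in> V"
      proof (rule ccontr)
        assume "w - d \<notin> V"
        from assms(3)[OF this] w show False by simp
      qed
      then show "w + - d \<in> W" using w by (simp add: W_def)
    next
      show "W \<noteq> {}" using v vd by (auto simp: W_def intro!: exI[of _ "v - d"])
    qed (use assms(2) in simp)
    then have "V = UNIV" unfolding W_def by blast
    then show False using assms(1) by simp
  qed
  have "x \<in> translate (steps d (- V) V) d \<longleftrightarrow> x \<in> V" for x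
  proof -
    have "x \<in> translate (steps d (- V) V) d \<longleftrightarrow> x - d \<notin> V \<and> x \<in> V" by simp
    then show ?thesis using iso by blast
  qed
  then have "translate (steps d (- V) V) d = V" by blast
  then show ?thesis using card_translate by metis
qed

lemma mod_ring_2_3_neq_0:
  assumes "CARD('p::prime_card) > 3"
  shows "(2 :: 'p mod_ring) \<noteq> 0" "(3 :: 'p mod_ring) \<noteq> 0"
  using of_nat_mod_ring_neq_0[of 2, where 'p='p] of_nat_mod_ring_neq_0[of 3, where 'p='p] assms
  by auto

section \<open>Rainbow-free colorings\<close>

text \<open>One entry is taken from each class, in a fixed order. The condition is invariant under
  permuting the classes, so a lemma about \<open>X\<close> applies to every class.\<close>

definition free_coloring ::
    "'p::prime_card mod_ring \<Rightarrow> 'p mod_ring set \<Rightarrow> 'p mod_ring set \<Rightarrow> 'p mod_ring set \<Rightarrow> bool" where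
  "free_coloring b X Y Z \<longleftrightarrow>
     three_coloring X Y Z \<and> (\<forall>x\<in>X. \<forall>y\<in>Y. \<forall>z\<in>Z. x + y + z \<noteq> b)"

lemma free_coloring_swap:
  assumes "free_coloring b X Y Z"
  shows "free_coloring b X Z Y" "free_coloring b Y X Z"
  using assms unfolding free_coloring_def three_coloring_def
  by (auto simp: algebra_simps Un_ac Int_commute) (metis add.left_commute add.commute)+

lemma free_coloring_classes:
  assumes "free_coloring b X Y Z"
  shows "- X = Y \<union> Z" "Y \<inter> Z = {}" "X \<noteq> {}" "X \<noteq> UNIV"
  using assms unfolding free_coloring_def three_coloring_def by auto

lemma three_coloring_card:
  fixes X :: "'p::prime_card mod_ring set"
  assumes "three_coloring X Y Z"
  shows "card X + card Y + card Z = CARD('p)"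
proof -
  have "card (X \<union> Y \<union> Z) = card X + card Y + card Z"
    using assms unfolding three_coloring_def
    by (subst card_Un_disjoint; simp add: card_Un_disjoint Int_Un_distrib2)
  moreover have "X \<union> Y \<union> Z = UNIV" using assms unfolding three_coloring_def by blast
  ultimately show ?thesis by simp
qed

lemma free_coloring_card:
  fixes X :: "'p::prime_card mod_ring set"
  assumes "free_coloring b X Y Z"
  shows "card X + card Y + card Z = CARD('p)"
  using assms three_coloring_card unfolding free_coloring_def by blast

lemma free_coloring_reflect:
  assumes "free_coloring b X Y Z" "r \<in> X" "r - d \<in> X" "q \<in> steps d Y Z \<union> steps d Z Y"
  shows "b - q - r \<in> X"
proof (rule ccontr)
  have no: "x + y + z \<noteq> b" if "x \<in> X" "y \<in> Y" "z \<in> Z" for x y z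
    using assms(1) that unfolding free_coloring_def by blast
  assume "b - q - r \<notin> X"
  then have "b - q - r \<in> Y \<union> Z" using free_coloring_classes(1)[OF assms(1)] by blast
  moreover have "r + q + (b - q - r) = b" "r + (b - q - r) + q = b"
    "(r - d) + (q + d) + (b - q - r) = b" "(r - d) + (b - q - r) + (q + d) = b"
    by (simp_all add: algebra_simps)
  ultimately show False using no assms(2-4) by (metis UnE mem_steps)
qed

text \<open>The third identity is conservation of flow at \<open>X\<close>; it turns later case
  distinctions into linear arithmetic.\<close>

lemma free_coloring_steps:
  assumes "free_coloring b X Y Z"
  shows "card (steps d (- X) X) = card (steps d Y X) + card (steps d Z X)"
    and "card (steps d X (- X)) = card (steps d X Y) + card (steps d X Z)"
    and "card (steps d X Y) + card (steps d X Z) = card (steps d Y X) + card (steps d Z X)"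
proof -
  show 1: "card (steps d (- X) X) = card (steps d Y X) + card (steps d Z X)"
    and 2: "card (steps d X (- X)) = card (steps d X Y) + card (steps d X Z)"
    using free_coloring_classes(1,2)[OF assms] card_steps_split by metis+
  show "card (steps d X Y) + card (steps d X Z) = card (steps d Y X) + card (steps d Z X)"
    using 1 2 card_steps_compl by metis
qed

lemma free_coloring_steps_pos:
  assumes "free_coloring b X Y Z" "d \<noteq> 0"
  shows "card (steps d X (- X)) \<noteq> 0"
proof
  assume "card (steps d X (- X)) = 0"
  then have "steps d X (- X) = {}" by (meson card_0_eq finite)
  then show False using no_steps_trivial[OF _ assms(2)] free_coloring_classes(3,4)[OF assms(1)] by blast
qed

section \<open>Classes consisting of one block\<close>

text \<open>A block that loses one point fits into a block of the original length in two adjacent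
  positions. This ambiguity of one step is what \<open>near\<close> records.\<close>

definition near :: "'p::prime_card mod_ring \<Rightarrow> 'p mod_ring \<Rightarrow> 'p mod_ring \<Rightarrow> bool" where
  "near d c c' \<longleftrightarrow> c' = c \<or> c' = c + d \<or> c' = c - d"

text \<open>Three distinct pairwise near points would be \<open>q - d\<close>, \<open>q\<close>,
  \<open>q + d\<close>; nearness of the outer two makes \<open>d\<close>, \<open>2 * d\<close> or
  \<open>3 * d\<close> vanish.\<close>

lemma card_near:
  fixes d :: "'p::prime_card mod_ring"
  assumes "\<And>c c'. c \<in> Q \<Longrightarrow> c' \<in> Q \<Longrightarrow> near d c c'" "CARD('p) > 3" "d \<noteq> 0"
  shows "card Q \<le> 2"
proof (cases "Q = {}")
  case False
  then obtain q where q: "q \<in> Q" by blast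
  have sub: "Q \<subseteq> {q, q + d, q - d}" using assms(1)[OF q] by (auto simp: near_def)
  have "\<not> (q + d \<in> Q \<and> q - d \<in> Q)"
  proof
    assume "q + d \<in> Q \<and> q - d \<in> Q"
    then have "near d (q - d) (q + d)" using assms(1) by blast
    then have "2 * d = 0 \<or> d = 0 \<or> 3 * d = 0"
    proof -
      have "3 * d = 2 * d + d" by simp
      then show ?thesis using \<open>near d (q - d) (q + d)\<close> unfolding near_def
        by (auto simp: algebra_simps)
    qed
    then show False using mod_ring_2_3_neq_0[OF assms(2)] assms(3) by auto
  qed
  then have "Q \<subseteq> {q, q + d} \<or> Q \<subseteq> {q, q - d}" using sub by blast
  then show ?thesis
  proof
    assume "Q \<subseteq> {q, q + d}"
    then have "card Q \<le> card {q, q + d}" by (rule card_mono[rotated]) simp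
    then show ?thesis using assms(3) by simp
  next
    assume "Q \<subseteq> {q, q - d}"
    then have "card Q \<le> card {q, q - d}" by (rule card_mono[rotated]) simp
    then show ?thesis using assms(3) by simp
  qed
qed simp

text \<open>The hypothesis applies to \<open>r\<close> only if \<open>r - d\<close> is also in
  \<open>X\<close>, so the first point of the block is given up. Reflection reverses the order: the
  last point of the block becomes the first of the image.\<close>

lemma ap_reflect_subset:
  assumes "\<And>r. r \<in> X \<Longrightarrow> r - d \<in> X \<Longrightarrow> c - r \<in> X" "ap d x m \<subseteq> X"
  shows "ap d (c - x - of_nat (m - 1) * d) (m - 1) \<subseteq> X"
proof
  fix z assume "z \<in> ap d (c - x - of_nat (m - 1) * d) (m - 1)"
  then obtain i where i: "i < m - 1" "z = c - x - of_nat (m - 1) * d + of_nat i * d"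
    by (auto simp: ap_def)
  \<comment> \<open>\<open>Suc k\<close> is the index of the point of the block whose mirror image
    is \<open>z\<close>.\<close>
  define k where "k = m - 2 - i"
  have k: "m - 1 = Suc k + i" "Suc k < m" using i(1) by (simp_all add: k_def)
  have "x + of_nat (Suc k) * d \<in> X" "x + of_nat k * d \<in> X"
    using assms(2) ap_I[of "Suc k" m x d] ap_I[of k m x d] k by auto
  moreover have "x + of_nat k * d = x + of_nat (Suc k) * d - d" by (simp add: algebra_simps)
  ultimately have "c - (x + of_nat (Suc k) * d) \<in> X" using assms(1) by simp
  moreover have "z = c - (x + of_nat (Suc k) * d)" unfolding i(2) k(1) by (simp add: algebra_simps)
  ultimately show "z \<in> X" by simp
qed

text \<open>\<open>Z\<close> touches only \<open>Y\<close>, once in each direction, at adjacent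
  places. If \<open>q' = q + d\<close>, then \<open>Z\<close> is left right after it is entered and
  is a single point; if \<open>q = q' + d\<close>, the same holds for the complement of
  \<open>Z\<close>, which contains \<open>X\<close>.\<close>

lemma pinched_class:
  fixes d :: "'p::prime_card mod_ring"
  assumes fc: "free_coloring b X Y Z" and d: "d \<noteq> 0"
    and YZ: "steps d Y Z = {q}" and ZY: "steps d Z Y = {q'}"
    and XZ: "steps d X Z = {}" "steps d Z X = {}"
    and n: "near d q q'" and big: "card X \<ge> 2" "card Z \<ge> 2"
  shows False
proof -
  note cX = free_coloring_classes[OF fc]
  have fc': "free_coloring b Z Y X" using fc free_coloring_swap by blast
  note cZ = free_coloring_classes[OF fc']
  have k: "card (steps d (- Z) Z) = 1" "card (steps d Z (- Z)) = 1"
    using free_coloring_steps(1,2)[OF fc', of d] YZ ZY XZ by simp_all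
  have "q \<in> Y" "q' \<in> Z" "q + d \<in> Z" "q' + d \<in> Y" using YZ ZY by (auto simp: set_eq_iff)
  then have "q \<noteq> q'" using cX(2) by blast
  then consider "q' = q + d" | "q = q' + d" using n by (auto simp: near_def)
  then show False
  proof cases
    case 1
    have "card Z = card (steps d (- Z) Z)"
    proof (rule card_isolated[OF cZ(4) d])
      fix v assume v: "v \<notin> Z" "v + d \<in> Z"
      then have "v \<in> steps d Y Z \<union> steps d X Z" using cZ(1) by auto
      then have "v = q" using YZ XZ by auto
      then show "v + d + d \<notin> Z" using 1 \<open>q' + d \<in> Y\<close> cX(2) by blast
    qed
    then show False using k big by simp
  next
    case 2
    have "card (- Z) = card (steps d (- (- Z)) (- Z))"
    proof (rule card_isolated[OF _ d])
      show "- Z \<noteq> UNIV" using cZ(3) by auto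
      fix v assume v: "v \<notin> - Z" "v + d \<in> - Z"
      then have "v \<in> steps d Z Y \<union> steps d Z X" using cZ(1) by auto
      then have "v = q'" using ZY XZ by auto
      then show "v + d + d \<notin> - Z" using 2 \<open>q + d \<in> Z\<close> by simp
    qed
    moreover have "card X \<le> card (- Z)" by (rule card_mono) (use cZ(1) in auto)
    ultimately show False using k big by simp
  qed
qed

text \<open>Here \<open>xy\<close> counts the steps from X to Y, and so on. The bound 2 comes from
  \<open>card_near\<close>, and the last two hypotheses exclude the configurations of
  \<open>pinched_class\<close>.\<close>

lemma flow_one_component:
  fixes xy xz yx yz zx zy :: nat
  assumes "xy + xz = 1" "yx + zx = 1" "xy + zy = yx + yz" "yz + zy \<le> 2"
    and "yx + yz \<noteq> 0" "zx + zy \<noteq> 0"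
    and "\<not> (yz = 1 \<and> zy = 1 \<and> xz = 0 \<and> zx = 0)" "\<not> (yz = 1 \<and> zy = 1 \<and> xy = 0 \<and> yx = 0)"
  shows "xy + zy = 1" "xz + yz = 1"
proof -
  have "(xy = 0 \<and> xz = 1 \<or> xy = 1 \<and> xz = 0) \<and> (yx = 0 \<and> zx = 1 \<or> yx = 1 \<and> zx = 0)"
    using assms(1,2) by auto
  moreover have "(zy = 0 \<or> zy = 1 \<or> zy = 2) \<and> (yz = 0 \<or> yz = 1 \<or> yz = 2)" using assms(4) by auto
  ultimately show "xy + zy = 1" "xz + yz = 1" using assms by auto
qed

lemma one_component_all:
  fixes d :: "'p::prime_card mod_ring"
  assumes fc: "free_coloring b X Y Z" and d: "d \<noteq> 0" and p3: "CARD('p) > 3"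
    and kX: "card (steps d (- X) X) = 1"
    and big: "card X \<ge> 2" "card Y \<ge> 2" "card Z \<ge> 2"
  shows "card (steps d (- Y) Y) = 1" "card (steps d (- Z) Z) = 1"
proof -
  obtain x m where m: "0 < m" "m < CARD('p)" "X = ap d x m"
    using one_component[OF kX d] by blast
  have m2: "m \<ge> 2" using big(1) card_ap[of d m x] d m by simp
  define Q where "Q = steps d Y Z \<union> steps d Z Y"
  \<comment> \<open>The eroded and reflected block has \<open>m - 1\<close> points and lies inside
    the block \<open>X\<close> of \<open>m\<close> points, so its offset is 0 or 1.\<close>
  have opt: "\<exists>j\<le>1. b - q = 2 * x + of_nat (m - 1) * d + of_nat j * d" if "q \<in> Q" for q
  proof -
    define f where "f = b - q - x - of_nat (m - 1) * d"
    have sub: "ap d f (m - 1) \<subseteq> X"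
      unfolding f_def
    proof (rule ap_reflect_subset)
      show "b - q - r \<in> X" if "r \<in> X" "r - d \<in> X" for r
        by (rule free_coloring_reflect[OF fc that]) (use \<open>q \<in> Q\<close> Q_def in auto)
    qed (use m in auto)
    then have "f \<in> ap d x m" using ap_start[of "m - 1" f d] m m2 by auto
    have "x + of_nat m * d \<notin> X" unfolding m(3) by (rule ap_end_notin[OF d m(2)])
    then obtain j where j: "j + (m - 1) \<le> m" "f = x + of_nat j * d"
      using ap_subset_component[OF sub \<open>f \<in> ap d x m\<close>] m2 by auto
    have "b - q = 2 * x + of_nat (m - 1) * d + of_nat j * d"
      using j(2) unfolding f_def by (simp add: algebra_simps)
    then show ?thesis using j(1) m2 by (intro exI[of _ j]) auto
  qed
  have near: "near d q q'" if qQ: "q \<in> Q" "q' \<in> Q" for q q'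
  proof -
    obtain j where j: "j \<le> 1" "b - q = 2 * x + of_nat (m - 1) * d + of_nat j * d"
      using opt[OF qQ(1)] by blast
    obtain j' where j': "j' \<le> 1" "b - q' = 2 * x + of_nat (m - 1) * d + of_nat j' * d"
      using opt[OF qQ(2)] by blast
    have "q' = q + (b - q) - (b - q')" by simp
    also have "\<dots> = q + of_nat j * d - of_nat j' * d" unfolding j(2) j'(2) by (simp add: algebra_simps)
    finally have "q' = q + of_nat j * d - of_nat j' * d" .
    moreover have "j = 0 \<or> j = 1" "j' = 0 \<or> j' = 1" using j(1) j'(1) by auto
    ultimately show ?thesis unfolding near_def by auto
  qed
  have "card Q \<le> 2" by (rule card_near[OF near p3 d])
  moreover have "card Q = card (steps d Y Z) + card (steps d Z Y)"
    unfolding Q_def by (rule card_Un_disjoint) (use free_coloring_classes(2)[OF fc] in auto)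
  ultimately have q2: "card (steps d Y Z) + card (steps d Z Y) \<le> 2" by simp
  have fY: "free_coloring b Y X Z" and fZ: "free_coloring b Z X Y" and fc': "free_coloring b X Z Y"
    using fc free_coloring_swap by blast+
  \<comment> \<open>In both excluded cases the two contacts are near, so
    \<open>pinched_class\<close> applies, with \<open>Y\<close> and \<open>Z\<close> exchanged in
    the second.\<close>
  have n1: "\<not> (card (steps d Y Z) = 1 \<and> card (steps d Z Y) = 1 \<and> card (steps d X Z) = 0 \<and> card (steps d Z X) = 0)"
  proof
    assume c: "card (steps d Y Z) = 1 \<and> card (steps d Z Y) = 1 \<and> card (steps d X Z) = 0 \<and> card (steps d Z X) = 0"
    then obtain q q' where q: "steps d Y Z = {q}" "steps d Z Y = {q'}" by (auto simp: card_1_singleton_iff)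
    have "q \<in> Q" "q' \<in> Q" using q by (auto simp: Q_def)
    then have "near d q q'" by (rule near)
    moreover have "steps d X Z = {}" "steps d Z X = {}" using c by (meson card_0_eq finite)+
    ultimately show False by (intro pinched_class[OF fc d q]) (use big in auto)
  qed
  have n2: "\<not> (card (steps d Y Z) = 1 \<and> card (steps d Z Y) = 1 \<and> card (steps d X Y) = 0 \<and> card (steps d Y X) = 0)"
  proof
    assume c: "card (steps d Y Z) = 1 \<and> card (steps d Z Y) = 1 \<and> card (steps d X Y) = 0 \<and> card (steps d Y X) = 0"
    then obtain q q' where q: "steps d Y Z = {q}" "steps d Z Y = {q'}" by (auto simp: card_1_singleton_iff)
    have "q \<in> Q" "q' \<in> Q" using q by (auto simp: Q_def)
    then have "near d q' q" by (intro near)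
    moreover have "steps d X Y = {}" "steps d Y X = {}" using c by (meson card_0_eq finite)+
    ultimately show False by (intro pinched_class[OF fc' d q(2,1)]) (use big in auto)
  qed
  have f1: "card (steps d X Y) + card (steps d X Z) = 1"
    "card (steps d Y X) + card (steps d Z X) = 1"
    using free_coloring_steps[OF fc, of d] kX by simp_all
  have f2: "card (steps d Y X) + card (steps d Y Z) \<noteq> 0" "card (steps d Z X) + card (steps d Z Y) \<noteq> 0"
    using free_coloring_steps_pos[OF fY d] free_coloring_steps(2)[OF fY, of d]
      free_coloring_steps_pos[OF fZ d] free_coloring_steps(2)[OF fZ, of d] by simp_all
  have f3: "card (steps d X Y) + card (steps d Z Y) = card (steps d Y X) + card (steps d Y Z)"
    using free_coloring_steps(3)[OF fY, of d] by simp
  note flow_one_component[OF f1 f3 q2 f2 n1 n2]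
  then have "card (steps d (- Y) Y) = 1 \<and> card (steps d (- Z) Z) = 1"
    using free_coloring_steps(1)[OF fY, of d] free_coloring_steps(1)[OF fZ, of d] by simp
  then show "card (steps d (- Y) Y) = 1" "card (steps d (- Z) Z) = 1" by auto
qed

section \<open>Classes consisting of two blocks\<close>

definition two_blocks ::
    "'p::prime_card mod_ring \<Rightarrow> 'p mod_ring set \<Rightarrow> 'p mod_ring \<Rightarrow> nat \<Rightarrow> 'p mod_ring \<Rightarrow> nat \<Rightarrow> bool"
  where "two_blocks d X x m y l \<longleftrightarrow> 0 < m \<and> 0 < l \<and> m < CARD('p) \<and> l < CARD('p) \<and>
    X = ap d x m \<union> ap d y l \<and> ap d x m \<inter> ap d y l = {} \<and>
    x + of_nat m * d \<notin> X \<and> y + of_nat l * d \<notin> X"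

lemma two_blocks_sym: "two_blocks d X x m y l \<Longrightarrow> two_blocks d X y l x m"
  unfolding two_blocks_def by auto

text \<open>The eroded reflection of the first block is a progression inside \<open>X\<close>, hence
  lies in one of the two blocks. The alternatives record the offset of its starting point
  there.\<close>

lemma two_blocks_reflect:
  assumes tb: "two_blocks d X x m y l" and m2: "2 \<le> m"
    and refl: "\<And>r. r \<in> X \<Longrightarrow> r - d \<in> X \<Longrightarrow> c - r \<in> X"
  shows "(\<exists>j\<le>1. c = 2 * x + of_nat (m - 1) * d + of_nat j * d) \<or>
    (\<exists>j. j + (m - 1) \<le> l \<and> c = x + y + of_nat (m - 1) * d + of_nat j * d)"
proof -
  define f where "f = c - x - of_nat (m - 1) * d"
  have c: "c = f + x + of_nat (m - 1) * d" by (simp add: f_def)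
  have sub: "ap d f (m - 1) \<subseteq> X" unfolding f_def
    by (rule ap_reflect_subset[OF refl]) (use tb in \<open>auto simp: two_blocks_def\<close>)
  then have "f \<in> ap d x m \<union> ap d y l" using ap_start[of "m - 1" f d] m2 tb unfolding two_blocks_def by auto
  then show ?thesis
  proof
    assume f: "f \<in> ap d x m"
    obtain j where j: "j + (m - 1) \<le> m" "f = x + of_nat j * d"
      by (rule ap_subset_component[OF sub f]) (use tb m2 in \<open>auto simp: two_blocks_def\<close>)
    have "c = 2 * x + of_nat (m - 1) * d + of_nat j * d"
      unfolding c j(2) by (simp add: algebra_simps)
    then show ?thesis using j(1) m2 by (intro disjI1 exI[of _ j]) auto
  next
    assume f: "f \<in> ap d y l"
    obtain j where j: "j + (m - 1) \<le> l" "f = y + of_nat j * d"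
      by (rule ap_subset_component[OF sub f]) (use tb m2 in \<open>auto simp: two_blocks_def\<close>)
    have "c = x + y + of_nat (m - 1) * d + of_nat j * d"
      unfolding c j(2) by (simp add: algebra_simps)
    then show ?thesis using j(1) by blast
  qed
qed

lemma two_blocks_disjoint:
  assumes "two_blocks d X x m y l" "i < m" "k < l"
  shows "x + of_nat i * d \<noteq> y + of_nat k * d"
  using assms ap_I[of i m x d] ap_I[of k l y d] unfolding two_blocks_def by auto

lemma two_blocks_interleaved:
  fixes d :: "'p::prime_card mod_ring"
  assumes "two_blocks d X x m y l" "m = l \<or> m = Suc l" "2 * (y - x) = d" "d \<noteq> 0"
  shows "is_ap X"
proof -
  define h where "h = y - x"
  have h: "d = 2 * h" "y = x + h" "h \<noteq> 0" using assms by (auto simp: h_def)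
  have "X = ap h x (m + l)" using assms(1) ap_interleave[OF assms(2), of h x]
    unfolding two_blocks_def h by simp
  then show ?thesis using h unfolding is_ap_def by blast
qed

text \<open>The reflected blocks must fit into the blocks of \<open>X\<close>. Unwanted placements
  put \<open>x\<close> and \<open>y\<close> so close that the blocks overlap, or half a step apart
  so that \<open>X\<close> is a progression.\<close>

lemma two_blocks_near:
  fixes d :: "'p::prime_card mod_ring"
  assumes tb: "two_blocks d X x m y l" and ml: "l \<le> m" "4 \<le> m + l" and nap: "\<not> is_ap X"
    and d: "d \<noteq> 0" and p3: "CARD('p) > 3"
    and refl: "\<And>r. r \<in> X \<Longrightarrow> r - d \<in> X \<Longrightarrow> c - r \<in> X"
      "\<And>r. r \<in> X \<Longrightarrow> r - d \<in> X \<Longrightarrow> c' - r \<in> X"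
  shows "near d c c'"
proof -
  have m2: "2 \<le> m" using ml by simp
  note two = mod_ring_2_3_neq_0[OF p3]
  note opt = two_blocks_reflect[OF tb m2] and opt' = two_blocks_reflect[OF two_blocks_sym[OF tb]]
  note dis = two_blocks_disjoint[OF tb]
  have ne: "x \<noteq> y" using dis[of 0 0] tb by (auto simp: two_blocks_def)
  have ne1: "y \<noteq> x + d" using dis[of 1 0] tb m2 by (auto simp: two_blocks_def)
  have near1: "near d e e'" if "j \<le> 1" "j' \<le> 1" "e = g + of_nat j * d" "e' = g + of_nat j' * d"
    for e e' g and j j' :: nat
  proof -
    have "j = 0 \<or> j = 1" "j' = 0 \<or> j' = 1" using that(1,2) by auto
    then show ?thesis unfolding near_def that(3,4) by auto
  qed
  consider (far) "m \<ge> l + 2" | (odd) "m = l + 1" | (even) "m = l" using ml by linarith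
  then show ?thesis
  proof cases
    case far
    \<comment> \<open>Even after erosion the first block is longer than the second, so it can only
      return to its own place.\<close>
    have "\<exists>j\<le>1. e = 2 * x + of_nat (m - 1) * d + of_nat j * d"
      if "\<And>r. r \<in> X \<Longrightarrow> r - d \<in> X \<Longrightarrow> e - r \<in> X" for e
      using opt[OF that] far by auto
    then show ?thesis using refl near1 by metis
  next
    case odd
    then have l2: "2 \<le> l" using ml by simp
    have ne2: "y \<noteq> x + 2 * d" using dis[of 2 0] l2 odd by auto
    have ne3: "x \<noteq> y + d" using dis[of 0 1] l2 odd by auto
    have l1: "(of_nat (m - 1) :: 'p mod_ring) * d = of_nat (l - 1) * d + d" 
      using odd l2 by (simp add: of_nat_diff algebra_simps)
    \<comment> \<open>The eroded first block has exactly the length of the second, so going there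
      leaves one value of \<open>e\<close>. Returning to its own place is refuted by placing the
      second block too.\<close>
    have "e = x + y + of_nat (m - 1) * d" if e: "\<And>r. r \<in> X \<Longrightarrow> r - d \<in> X \<Longrightarrow> e - r \<in> X" for e
      using opt[OF e]
    proof
      assume "\<exists>j\<le>1. e = 2 * x + of_nat (m - 1) * d + of_nat j * d"
      then obtain j where j: "j \<le> 1" "e = 2 * x + (of_nat (l - 1) * d + d) + of_nat j * d"
        unfolding l1 by blast
      have j01: "j = 0 \<or> j = 1" using j(1) by auto
      from opt'[OF l2 e] have False
      proof
        assume "\<exists>j'\<le>1. e = 2 * y + of_nat (l - 1) * d + of_nat j' * d"
        then obtain j' where j': "j' \<le> 1" "e = 2 * y + of_nat (l - 1) * d + of_nat j' * d" by blast
        have "2 * (y - x) = d + of_nat j * d - of_nat j' * d" using j(2) j'(2) by (simp add: algebra_simps)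
        moreover have "j' = 0 \<or> j' = 1" using j'(1) by auto
        ultimately consider "2 * (y - x) = 0" | "2 * (y - x) = d" | "2 * (y - x) = 2 * d"
          using j01 by fastforce
        then show False
        proof cases
          case 1
          then show ?thesis using ne two(1) by simp
        next
          case 2
          then show ?thesis using two_blocks_interleaved[OF tb _ _ d] nap odd by simp
        next
          case 3
          then have "y - x = d" using two(1) mult_left_cancel by blast
          then show ?thesis using ne1 by (simp add: diff_eq_eq add.commute)
        qed
      next
        assume "\<exists>j'. j' + (l - 1) \<le> m \<and> e = y + x + of_nat (l - 1) * d + of_nat j' * d"
        then obtain j' where j': "j' + (l - 1) \<le> m" "e = y + x + of_nat (l - 1) * d + of_nat j' * d"
          by blast
        have "y = x + d + of_nat j * d - of_nat j' * d" using j(2) j'(2) by (simp add: algebra_simps)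
        moreover have "j' = 0 \<or> j' = 1 \<or> j' = 2" using j'(1) odd l2 by auto
        ultimately show False using j01 ne ne1 ne2 ne3 by (auto simp: algebra_simps)
      qed
      then show ?thesis ..
    next
      assume "\<exists>j. j + (m - 1) \<le> l \<and> e = x + y + of_nat (m - 1) * d + of_nat j * d"
      then show ?thesis using odd by auto
    qed
    then show ?thesis using refl unfolding near_def by metis
  next
    case even
    have ne3: "x \<noteq> y + d" using dis[of 0 1] m2 even by auto
    \<comment> \<open>With equal lengths the eroded block goes to the other block with offset 0 or
      1; its own place is refuted by placing the second block too.\<close>
    have "\<exists>j\<le>1. e = x + y + of_nat (m - 1) * d + of_nat j * d"
      if e: "\<And>r. r \<in> X \<Longrightarrow> r - d \<in> X \<Longrightarrow> e - r \<in> X" for e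
      using opt[OF e]
    proof
      assume "\<exists>j\<le>1. e = 2 * x + of_nat (m - 1) * d + of_nat j * d"
      then obtain j where j: "j \<le> 1" "e = 2 * x + of_nat (m - 1) * d + of_nat j * d" by blast
      have j01: "j = 0 \<or> j = 1" using j(1) by auto
      have l2: "2 \<le> l" using m2 even by simp
      from opt'[OF l2 e] have False
      proof
        assume "\<exists>j'\<le>1. e = 2 * y + of_nat (l - 1) * d + of_nat j' * d"
        then obtain j' where j': "j' \<le> 1" "e = 2 * y + of_nat (m - 1) * d + of_nat j' * d"
          unfolding even by blast
        have "2 * (y - x) = of_nat j * d - of_nat j' * d" using j(2) j'(2) by (simp add: algebra_simps)
        moreover have "j' = 0 \<or> j' = 1" using j'(1) by auto
        ultimately have "2 * (y - x) = 0 \<or> 2 * (y - x) = d \<or> 2 * (y - x) = - d"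
          using j01 by auto
        moreover have "2 * (y - x) = - d \<Longrightarrow> 2 * (x - y) = d" by (simp add: algebra_simps)
        ultimately show False
          using ne two two_blocks_interleaved[OF tb _ _ d]
            two_blocks_interleaved[OF two_blocks_sym[OF tb] _ _ d] nap even
          by auto
      next
        assume "\<exists>j'. j' + (l - 1) \<le> m \<and> e = y + x + of_nat (l - 1) * d + of_nat j' * d"
        then obtain j' where j': "j' + (m - 1) \<le> m" "e = y + x + of_nat (m - 1) * d + of_nat j' * d"
          unfolding even by blast
        have "y = x + of_nat j * d - of_nat j' * d" using j(2) j'(2) by (simp add: algebra_simps)
        moreover have "j' = 0 \<or> j' = 1" using j'(1) m2 by auto
        ultimately show False using j01 ne ne1 ne3 by (auto simp: algebra_simps)
      qed
      then show ?thesis ..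
    next
      assume "\<exists>j. j + (m - 1) \<le> l \<and> e = x + y + of_nat (m - 1) * d + of_nat j * d"
      then obtain j where "j + (m - 1) \<le> l" "e = x + y + of_nat (m - 1) * d + of_nat j * d" by blast
      then show ?thesis using even m2 by (intro exI[of _ j]) auto
    qed
    then show ?thesis using refl near1 by metis
  qed
qed

lemma two_components_near:
  fixes d :: "'p::prime_card mod_ring"
  assumes fc: "free_coloring b X Y Z" and d: "d \<noteq> 0" and p3: "CARD('p) > 3"
    and kX: "card (steps d (- X) X) = 2" and X4: "card X \<ge> 4" and nap: "\<not> is_ap X"
    and q: "q \<in> steps d Y Z \<union> steps d Z Y" "q' \<in> steps d Y Z \<union> steps d Z Y"
  shows "near d q q'"
proof -
  obtain x m y l where tb: "two_blocks d X x m y l"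
    using two_components[OF kX d] unfolding two_blocks_def by metis
  have "card X \<le> card (ap d x m) + card (ap d y l)"
    using tb card_Un_le unfolding two_blocks_def by metis
  also have "\<dots> = m + l" using tb d unfolding two_blocks_def by (simp add: card_ap)
  finally have ml: "4 \<le> m + l" "4 \<le> l + m" using X4 by simp_all
  have "b - q - r \<in> X" "b - q' - r \<in> X" if "r \<in> X" "r - d \<in> X" for r
    using free_coloring_reflect[OF fc that] q by auto
  then have "near d (b - q) (b - q')"
    using two_blocks_near[OF tb _ ml(1) nap d p3] two_blocks_near[OF two_blocks_sym[OF tb] _ ml(2) nap d p3]
    by (cases "l \<le> m") auto
  then show ?thesis unfolding near_def by (auto simp: algebra_simps)
qed

text \<open>Two steps from \<open>Y\<close> to \<open>Z\<close> are never consecutive, since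
  \<open>q + d\<close> would lie in both sets; so near ones coincide.\<close>

lemma card_steps_near_le_1:
  fixes d :: "'p::prime_card mod_ring"
  assumes "\<And>q q'. q \<in> steps d Y Z \<Longrightarrow> q' \<in> steps d Y Z \<Longrightarrow> near d q q'" "Y \<inter> Z = {}"
  shows "card (steps d Y Z) \<le> 1"
proof -
  have "q = q'" if q: "q \<in> steps d Y Z" "q' \<in> steps d Y Z" for q q'
  proof -
    have "q' \<noteq> q + d" "q \<noteq> q' + d" using q assms(2) by auto
    then show ?thesis using assms(1)[OF q] unfolding near_def by (auto simp: eq_diff_eq)
  qed
  then show ?thesis by (metis card_le_Suc0_iff_eq finite One_nat_def)
qed

text \<open>\<open>q + d\<close> is an isolated point of \<open>Z\<close> between points of
  \<open>Y\<close>, and \<open>r + d\<close> an isolated point of \<open>X\<close> between points of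
  \<open>Z\<close>.\<close>

lemma mixed_pinching:
  fixes d :: "'p::prime_card mod_ring"
  assumes fc: "free_coloring b X Y Z" and d: "d \<noteq> 0" and X2: "card X \<ge> 2"
    and YZ: "steps d Y Z = {q}" and ZY: "steps d Z Y = {q + d}"
    and XZ: "steps d X Z = {r + d}" and ZX: "steps d Z X = {r}"
  shows False
proof -
  have fc': "free_coloring b Z Y X" "free_coloring b Y X Z" using fc free_coloring_swap by blast+
  note cZ = free_coloring_classes[OF fc'(1)] and cX = free_coloring_classes[OF fc]
    and cY = free_coloring_classes[OF fc'(2)]
  have m: "q \<in> Y" "q + d \<in> Z" "q + d + d \<in> Y" "r \<in> Z" "r + d \<in> X" "r + d + d \<in> Z"
  proof -
    have "q \<in> steps d Y Z" "q + d \<in> steps d Z Y" "r + d \<in> steps d X Z" "r \<in> steps d Z X"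
      using YZ ZY XZ ZX by blast+
    then show "q \<in> Y" "q + d \<in> Z" "q + d + d \<in> Y" "r \<in> Z" "r + d \<in> X" "r + d + d \<in> Z"
      unfolding mem_steps by blast+
  qed
  \<comment> \<open>Adding \<open>q + d\<close> to the complement of \<open>Z\<close> leaves
    \<open>r\<close> as the only entry into it, and \<open>V\<close> is left at once. So
    \<open>V\<close> is a single point, although it contains \<open>X\<close>.\<close>
  define V where "V = - (Z - {q + d})"
  have only: "v = r" if v: "v \<notin> V" "v + d \<in> V" for v
  proof -
    have v': "v \<in> Z" "v \<noteq> q + d" "v + d \<notin> Z \<or> v + d = q + d" using v by (auto simp: V_def)
    then have "v + d \<notin> Z" using m(1) cX(2) by auto
    then have "v \<in> steps d Z Y \<union> steps d Z X" using v'(1) cZ(1) by auto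
    then show ?thesis using ZY ZX v'(2) by auto
  qed
  have "card V = card (steps d (- V) V)"
  proof (rule card_isolated[OF _ d])
    have "r \<noteq> q + d" using m(3,5) cZ(2) by auto
    then have "r \<notin> V" using m(4) by (simp add: V_def)
    then show "V \<noteq> UNIV" by blast
    fix v assume "v \<notin> V" "v + d \<in> V"
    then have "v = r" by (rule only)
    moreover have "r + d + d \<noteq> q + d" using m(1,5) cZ(2) by (metis IntI add_right_cancel empty_iff)
    ultimately show "v + d + d \<notin> V" using m by (auto simp: V_def)
  qed
  also have "\<dots> \<le> card {r}" by (rule card_mono) (use only in auto)
  finally have "card V \<le> 1" by simp
  moreover have "card X \<le> card V" by (rule card_mono) (use cX(2) cZ(1) in \<open>auto simp: V_def\<close>)
  ultimately show False using X2 by simp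
qed

text \<open>Y and Z need two entries each, X provides two in total, and at most one step leads from
  Y to Z and one back. So all bounds are tight.\<close>

lemma flow_two_components:
  fixes xy xz yx yz zx zy :: nat
  assumes "yx + zx = 2" "xy + xz = 2" "xy + zy \<ge> 2" "xz + yz \<ge> 2" "yz \<le> 1" "zy \<le> 1"
  shows "yz = 1" "zy = 1" "xz = 1" "xy = 1"
  using assms by linarith+

text \<open>The flow forces exactly one step in each direction between any two classes, so
  \<open>Y\<close> and \<open>Z\<close> have two blocks as well. Reflecting \<open>X\<close> and
  \<open>Y\<close> makes the contacts of \<open>Z\<close> with either neighbour adjacent, and the
  four possible orders are excluded one by one.\<close>

lemma no_two_component_class:
  fixes d :: "'p::prime_card mod_ring"
  assumes fc: "free_coloring b X Y Z" and d: "d \<noteq> 0" and p3: "CARD('p) > 3"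
    and kX: "card (steps d (- X) X) = 2"
    and big: "card X \<ge> 4" "card Y \<ge> 4" "card Z \<ge> 3"
    and nap: "\<not> is_ap X" "\<not> is_ap Y" "\<not> is_ap Z"
  shows False
proof -
  have fY: "free_coloring b Y X Z" and fZ: "free_coloring b Z X Y" 
    using fc free_coloring_swap by blast+
  note cX = free_coloring_classes[OF fc] and cY = free_coloring_classes[OF fY]
    and cZ = free_coloring_classes[OF fZ]
  note nearX = two_components_near[OF fc d p3 kX big(1) nap(1)]
  have yz: "card (steps d Y Z) \<le> 1"
    by (rule card_steps_near_le_1[OF nearX]) (use cX(2) in auto)
  have zy: "card (steps d Z Y) \<le> 1"
    by (rule card_steps_near_le_1[OF nearX]) (use cX(2) in auto)
  have k: "card (steps d (- Y) Y) \<noteq> 0" "card (steps d (- Y) Y) \<noteq> 1"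
    "card (steps d (- Z) Z) \<noteq> 0" "card (steps d (- Z) Z) \<noteq> 1"
    using free_coloring_steps_pos[OF fY d] free_coloring_steps_pos[OF fZ d] card_steps_compl
      is_ap_one_component[OF _ d] nap by metis+
  have kY: "card (steps d (- Y) Y) = card (steps d X Y) + card (steps d Z Y)"
    and kZ: "card (steps d (- Z) Z) = card (steps d X Z) + card (steps d Y Z)"
    by (rule free_coloring_steps(1)[OF fY], rule free_coloring_steps(1)[OF fZ])
  have f1: "card (steps d Y X) + card (steps d Z X) = 2" "card (steps d X Y) + card (steps d X Z) = 2"
    using free_coloring_steps[OF fc, of d] kX by simp_all
  have f2: "card (steps d X Y) + card (steps d Z Y) \<ge> 2" "card (steps d X Z) + card (steps d Y Z) \<ge> 2"
    using k unfolding kY kZ by linarith+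
  note f = flow_two_components[OF f1 f2 yz zy]
  have "card (steps d Z X) = 1"
    using free_coloring_steps(3)[OF fZ, of d] f by simp
  then have c: "card (steps d Y Z) = 1" "card (steps d Z Y) = 1" "card (steps d X Z) = 1"
    "card (steps d Z X) = 1" "card (steps d (- Y) Y) = 2" "card (steps d (- Z) Z) = 2"
    using f kY kZ by simp_all
  obtain q q' r r' where q: "steps d Y Z = {q}" "steps d Z Y = {q'}"
    and r: "steps d X Z = {r}" "steps d Z X = {r'}"
    using c(1-4) by (metis card_1_singletonE)
  have m: "q \<in> Y" "q + d \<in> Z" "q' \<in> Z" "q' + d \<in> Y" "r \<in> X" "r + d \<in> Z" "r' \<in> Z" "r' + d \<in> X"
    using q r by (auto simp: set_eq_iff)
  have "near d q q'" using nearX q by auto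
  moreover have "q \<noteq> q'" using m cX(2) by auto
  ultimately have nq: "q' = q + d \<or> q = q' + d" by (auto simp: near_def)
  have "near d r r'" using two_components_near[OF fY d p3 c(5) big(2) nap(2)] r by auto
  moreover have "r \<noteq> r'" using m cY(2) by auto
  ultimately have nr: "r' = r + d \<or> r = r' + d" by (auto simp: near_def)
  consider (a) "q' = q + d" "r' = r + d" | (b) "q = q' + d" "r = r' + d"
    | (c) "q' = q + d" "r = r' + d" | (d) "q = q' + d" "r' = r + d" using nq nr by blast
  then show False
  proof cases
    case a
    \<comment> \<open>Both visits to \<open>Z\<close> last one point, so \<open>Z\<close> has only
      two points.\<close>
    have "card Z = card (steps d (- Z) Z)"
    proof (rule card_isolated[OF cZ(4) d])
      fix v assume v: "v \<notin> Z" "v + d \<in> Z"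
      then have "v \<in> steps d X Z \<union> steps d Y Z" using cZ(1) by auto
      then have "v = r \<or> v = q" using q r by auto
      then have "v + d = r' \<or> v + d = q'" using a by auto
      then show "v + d + d \<notin> Z" using m cX(2) cY(2) by auto
    qed
    then show False using c(6) big by simp
  next
    case b
    \<comment> \<open>Now both visits to the complement of \<open>Z\<close> last one point, although
      it contains \<open>X\<close>.\<close>
    have "card (- Z) = card (steps d (- (- Z)) (- Z))"
    proof (rule card_isolated[OF _ d])
      show "- Z \<noteq> UNIV" using cZ(3) by auto
      fix v assume v: "v \<notin> - Z" "v + d \<in> - Z"
      then have "v \<in> steps d Z X \<union> steps d Z Y" using cZ(1) by auto
      then have "v = r' \<or> v = q'" using q r by auto
      then have "v + d = r \<or> v + d = q" using b by auto
      then show "v + d + d \<notin> - Z" using m by auto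
    qed
    then have "card (- Z) = 2" using c(6) card_steps_compl by (metis double_compl)
    moreover have "card X \<le> card (- Z)" by (rule card_mono) (use cZ(1) in auto)
    ultimately show False using big by simp
  next
    case c
    show False by (rule mixed_pinching[OF fc d, of q r']) (use big q r c in auto)
  next
    case d
    show False by (rule mixed_pinching[OF fY assms(2), of r q']) (use big q r d in auto)
  qed
qed

section \<open>From one progression class to three consecutive blocks\<close>

lemma is_ap_imp_one_component:
  fixes X :: "'p::prime_card mod_ring set"
  assumes "is_ap X" "X \<noteq> {}" "X \<noteq> UNIV"
  obtains d where "d \<noteq> 0" "card (steps d (- X) X) = 1"
proof -
  obtain d x m where d: "d \<noteq> 0" "X = ap d x m" using assms(1) unfolding is_ap_def by blast
  have sub: "steps d (- X) X \<subseteq> {x - d}"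
  proof
    fix y assume y: "y \<in> steps d (- X) X"
    then obtain i where i: "i < m" "y + d = x + of_nat i * d" using d by (auto simp: ap_def)
    have "i = 0"
    proof (rule ccontr)
      assume "i \<noteq> 0"
      then obtain k where k: "i = Suc k" by (cases i) auto
      then have "y = x + of_nat k * d" using i(2) by (simp add: algebra_simps)
      then have "y \<in> X" using ap_I[of k m x d] d k i(1) by simp
      then show False using y by simp
    qed
    then show "y \<in> {x - d}" using i(2) by (simp add: eq_diff_eq)
  qed
  have "steps d (- X) X \<noteq> {}"
  proof
    assume "steps d (- X) X = {}"
    then have "card (steps d X (- X)) = 0" using card_steps_compl[of d X] by simp
    then show False using no_steps_trivial[OF _ d(1)] assms(2,3) by (meson card_0_eq finite)
  qed
  then have "steps d (- X) X = {x - d}" using sub by blast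
  then show thesis using that d(1) by simp
qed

lemma steps_uminus: "card (steps (- d) X Y) = card (steps d Y X)"
proof -
  have "translate (steps d Y X) d = steps (- d) X Y" by auto
  then show ?thesis using card_translate by metis
qed

text \<open>The last point \<open>e\<close> of \<open>A\<close> must step into \<open>B\<close>, and
  the only entry into \<open>B\<close> is at \<open>t - d\<close>.\<close>

lemma oriented_blocks:
  fixes d :: "'p::prime_card mod_ring"
  assumes fc: "free_coloring b A B C" and d: "d \<noteq> 0"
    and AC: "steps d A C = {}"
    and A: "A = ap d s m" "0 < m" "m < CARD('p)" and B: "steps d (- B) B = {t - d}"
  shows "t = s + of_nat m * d"
proof -
  note cA = free_coloring_classes[OF fc]
  define e where "e = s + of_nat (m - 1) * d"
  have ed: "e + d = s + of_nat m * d" using A(2) by (simp add: e_def algebra_simps of_nat_diff)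
  have e: "e \<in> A" unfolding A(1) e_def by (rule ap_I) (use A(2) in simp)
  have "e + d \<notin> A" unfolding ed A(1) by (rule ap_end_notin[OF d A(3)])
  then have "e + d \<in> B \<union> C" using cA(1) by blast
  then have eB: "e + d \<in> B" using AC e by (auto simp: set_eq_iff)
  moreover have "e \<notin> B" using e cA(1) by blast
  ultimately have "e = t - d" using B by (auto simp: set_eq_iff)
  then show ?thesis using ed by simp
qed

lemma sum_of_blocks:
  fixes d :: "'p::prime_card mod_ring"
  assumes fc: "free_coloring b A B C" and d: "d \<noteq> 0"
    and k: "card (steps d (- A) A) = 1" "card (steps d (- B) B) = 1" "card (steps d (- C) C) = 1"
    and o: "steps d A C = {}" "steps d B A = {}" "steps d C B = {}"
  obtains s t u where "A = ap d s (card A)" "B = ap d t (card B)" "C = ap d u (card C)"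
    "t = s + of_nat (card A) * d" "u = t + of_nat (card B) * d" "s = u + of_nat (card C) * d"
    "s + t + u \<in> {b + d, b + 2 * d}"
proof -
  obtain s m where A: "0 < m" "m < CARD('p)" "A = ap d s m" "steps d (- A) A = {s - d}"
    by (rule one_component[OF k(1) d])
  obtain t n where B: "0 < n" "n < CARD('p)" "B = ap d t n" "steps d (- B) B = {t - d}"
    by (rule one_component[OF k(2) d])
  obtain u l where C: "0 < l" "l < CARD('p)" "C = ap d u l" "steps d (- C) C = {u - d}"
    by (rule one_component[OF k(3) d])
  have card: "card A = m" "card B = n" "card C = l"
    unfolding A(3) B(3) C(3) using A(2) B(2) C(2) by (simp_all add: card_ap[OF d])
  have fB: "free_coloring b B C A" and fC: "free_coloring b C A B"
    using fc free_coloring_swap by blast+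
  note t = oriented_blocks[OF fc d o(1) A(3,1,2) B(4)]
    and u = oriented_blocks[OF fB d o(2) B(3,1,2) C(4)]
    and s = oriented_blocks[OF fC d o(3) C(3,1,2) A(4)]
  obtain z where z: "z < CARD('p)" "b - (s + t + u) = of_nat z * d"
    using mod_ring_multiple[OF d] by blast
  have sum: "m + n + l = CARD('p)" using free_coloring_card[OF fc] card by simp
  \<comment> \<open>The sums of one point from each block are \<open>s + t + u\<close> plus the
    multiples of \<open>d\<close> by 0 up to p - 3: a small \<open>z\<close> splits greedily into
    indices of the three blocks.\<close>
  have "\<not> z \<le> (m - 1) + (n - 1) + (l - 1)"
  proof
    assume zle: "z \<le> (m - 1) + (n - 1) + (l - 1)"
    define i where "i = min z (m - 1)"
    define j where "j = min (z - i) (n - 1)"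
    define k where "k = z - i - j"
    have ijk: "i < m" "j < n" "k < l" "z = i + j + k"
      using zle A(1) B(1) C(1) by (auto simp: i_def j_def k_def min_def split: if_splits)
    have "s + of_nat i * d \<in> A" "t + of_nat j * d \<in> B" "u + of_nat k * d \<in> C"
      unfolding A(3) B(3) C(3) using ijk(1-3) by (simp_all add: ap_I)
    moreover have "(s + of_nat i * d) + (t + of_nat j * d) + (u + of_nat k * d) = s + t + u + of_nat z * d"
      unfolding ijk(4) by (simp add: algebra_simps)
    then have "(s + of_nat i * d) + (t + of_nat j * d) + (u + of_nat k * d) = b"
      unfolding z(2)[symmetric] by simp
    ultimately show False using fc unfolding free_coloring_def by blast
  qed
  \<comment> \<open>Only \<open>z = p - 1\<close> and \<open>z = p - 2\<close> remain; they give the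
    two admissible values of \<open>s + t + u\<close>.\<close>
  then have "z + 1 = CARD('p) \<or> z + 2 = CARD('p)" using z(1) sum A(1) B(1) C(1) by linarith
  then have "(of_nat (z + 1) :: 'p mod_ring) = 0 \<or> (of_nat (z + 2) :: 'p mod_ring) = 0"
  proof
    assume "z + 1 = CARD('p)"
    then have "(of_nat (z + 1) :: 'p mod_ring) = 0" by (simp only: of_nat_card_eq_0)
    then show ?thesis ..
  next
    assume "z + 2 = CARD('p)"
    then have "(of_nat (z + 2) :: 'p mod_ring) = 0" by (simp only: of_nat_card_eq_0)
    then show ?thesis ..
  qed
  then have "of_nat (z + 1) * d = 0 \<or> of_nat (z + 2) * d = 0" by auto
  moreover have "of_nat (z + 1) * d = b + d - (s + t + u)" "of_nat (z + 2) * d = b + 2 * d - (s + t + u)"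
    by (simp_all add: distrib_right z(2)[symmetric])
  ultimately have "s + t + u \<in> {b + d, b + 2 * d}" by auto
  then show thesis by (rule that[unfolded card, OF A(3) B(3) C(3) t u s])
qed

text \<open>Each class is entered and left once, so the classes follow one another in one of the two
  cyclic orders.\<close>

lemma flow_orientation:
  fixes ab ac ba bc ca cb :: nat
  assumes "ba + ca = 1" "ab + ac = 1" "ab + cb = 1" "ba + bc = 1" "ac + bc = 1"
  shows "ac = 0 \<and> ba = 0 \<and> cb = 0 \<or> ca = 0 \<and> ab = 0 \<and> bc = 0"
proof -
  have "ab = 0 \<or> ab = 1" using assms by linarith
  then show ?thesis using assms by auto
qed

lemma blocks_of_ap_class:
  fixes b :: "'p::prime_card mod_ring"
  assumes fc: "free_coloring b A B C" and p3: "CARD('p) > 3"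
    and big: "card A \<ge> 2" "card B \<ge> 2" "card C \<ge> 2"
    and ap: "is_ap A \<or> is_ap B \<or> is_ap C"
  obtains d s t u where "d \<noteq> 0" "A = ap d s (card A)" "B = ap d t (card B)" "C = ap d u (card C)"
    "t = s + of_nat (card A) * d" "u = t + of_nat (card B) * d" "s = u + of_nat (card C) * d"
    "s + t + u \<in> {b + d, b + 2 * d}"
proof -
  have fB: "free_coloring b B A C" and fC: "free_coloring b C A B"
    using fc free_coloring_swap by blast+
  note cA = free_coloring_classes[OF fc] and cB = free_coloring_classes[OF fB]
    and cC = free_coloring_classes[OF fC]
  obtain e where e: "e \<noteq> 0" "card (steps e (- A) A) = 1" "card (steps e (- B) B) = 1"
    "card (steps e (- C) C) = 1"
    using ap
  proof (elim disjE)
    assume "is_ap A"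
    then obtain e where e: "e \<noteq> 0" "card (steps e (- A) A) = 1"
      using is_ap_imp_one_component cA(3,4) by blast
    then show thesis using that one_component_all[OF fc e(1) p3 e(2) big] by blast
  next
    assume "is_ap B"
    then obtain e where e: "e \<noteq> 0" "card (steps e (- B) B) = 1"
      using is_ap_imp_one_component cB(3,4) by blast
    then show thesis using that one_component_all[OF fB e(1) p3 e(2) big(2,1,3)] by blast
  next
    assume "is_ap C"
    then obtain e where e: "e \<noteq> 0" "card (steps e (- C) C) = 1"
      using is_ap_imp_one_component cC(3,4) by blast
    then show thesis using that one_component_all[OF fC e(1) p3 e(2) big(3,1,2)] by blast
  qed
  have empty: "steps e X Y = {}" if "card (steps e X Y) = 0" for X Y using that by (meson card_0_eq finite)
  have "card (steps e A C) = 0 \<and> card (steps e B A) = 0 \<and> card (steps e C B) = 0 \<or>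
      card (steps e C A) = 0 \<and> card (steps e A B) = 0 \<and> card (steps e B C) = 0"
    by (rule flow_orientation)
      (use free_coloring_steps(1,3)[OF fc, of e] free_coloring_steps(1,3)[OF fB, of e]
        free_coloring_steps(1)[OF fC, of e] e in simp_all)
  then show thesis
  proof
    assume "card (steps e A C) = 0 \<and> card (steps e B A) = 0 \<and> card (steps e C B) = 0"
    then have "steps e A C = {}" "steps e B A = {}" "steps e C B = {}" using empty by blast+
    then show thesis by (rule sum_of_blocks[OF fc e]) (rule that[OF e(1)])
  next
    assume z: "card (steps e C A) = 0 \<and> card (steps e A B) = 0 \<and> card (steps e B C) = 0"
    \<comment> \<open>Passing to \<open>- e\<close> reverses the cyclic order and keeps the number
      of blocks.\<close>
    have e': "- e \<noteq> 0" "card (steps (- e) (- A) A) = 1" "card (steps (- e) (- B) B) = 1"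
      "card (steps (- e) (- C) C) = 1"
      using e by (simp_all add: steps_uminus card_steps_compl)
    have "card (steps (- e) A C) = 0" "card (steps (- e) B A) = 0" "card (steps (- e) C B) = 0"
      using z by (simp_all add: steps_uminus)
    then have "steps (- e) A C = {}" "steps (- e) B A = {}" "steps (- e) C B = {}"
      by (meson card_0_eq finite)+
    then show thesis by (rule sum_of_blocks[OF fc e']) (rule that[OF e'(1)])
  qed
qed

section \<open>Sets with small sumset\<close>

text \<open>Keeping \<open>T\<close> explicit instead of the sumset lets the sets trade places, by
  \<open>sum_avoids_commute\<close> and \<open>sum_avoids_dual\<close>.\<close>

definition sum_avoids :: "'p::prime_card mod_ring set \<Rightarrow> 'p mod_ring set \<Rightarrow> 'p mod_ring set \<Rightarrow> bool"
  where "sum_avoids X S T \<longleftrightarrow> (\<forall>x\<in>X. \<forall>s\<in>S. x + s \<notin> T)"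

text \<open>The intersection counts the representations of \<open>g\<close> as a difference of two
  elements of \<open>S\<close>.\<close>

definition sidon :: "'p::prime_card mod_ring set \<Rightarrow> bool" where
  "sidon S \<longleftrightarrow> (\<forall>g. g \<noteq> 0 \<longrightarrow> card (S \<inter> translate S g) \<le> 1)"

lemma mem_uminus_image [simp]: "(x :: 'p::prime_card mod_ring) \<in> uminus ` X \<longleftrightarrow> - x \<in> X"
  by (metis add.inverse_inverse image_iff)

lemma card_uminus_image [simp]: "card (uminus ` (X :: 'p::prime_card mod_ring set)) = card X"
  by (rule card_image) (simp add: inj_on_def)

lemma sum_avoids_commute: "sum_avoids X S T \<longleftrightarrow> sum_avoids S X T"
  unfolding sum_avoids_def by (metis add.commute)

text \<open>\<open>x + s = t\<close> is the same as \<open>- x + t = s\<close>. This is why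
  \<open>X\<close> and its negative are treated together below.\<close>

lemma sum_avoids_dual: "sum_avoids X S T \<Longrightarrow> sum_avoids (uminus ` X) T S"
  unfolding sum_avoids_def by (metis add_minus_cancel mem_uminus_image)

lemma sum_avoids_translate: "sum_avoids X S T \<Longrightarrow> sum_avoids X (translate S g) (translate T g)"
  unfolding sum_avoids_def by (simp add: add_diff_eq[symmetric])

lemma sum_avoids_disjoint: "sum_avoids X S T \<Longrightarrow> x \<in> X \<Longrightarrow> translate S x \<inter> T = {}"
  unfolding sum_avoids_def disjoint_iff mem_translate by (metis add.commute diff_add_cancel)

lemma card_disjoint_le:
  fixes A T :: "'p::prime_card mod_ring set"
  assumes "A \<inter> T = {}"
  shows "card A + card T \<le> CARD('p)"
proof -
  have "card A + card T = card (A \<union> T)" using assms by (simp add: card_Un_disjoint)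
  also have "\<dots> \<le> card (UNIV :: 'p mod_ring set)" by (rule card_mono) auto
  finally show ?thesis by simp
qed

lemma card_compl: "card (- A) = CARD('p) - card (A :: 'p::prime_card mod_ring set)"
  by (simp add: Compl_eq_Diff_UNIV card_Diff_subset)

lemma card_Int_translate_less:
  fixes S :: "'p::prime_card mod_ring set"
  assumes "g \<noteq> 0" "S \<noteq> {}" "S \<noteq> UNIV"
  shows "card (S \<inter> translate S g) < card S"
proof (rule psubset_card_mono)
  have "S \<inter> translate S g \<noteq> S"
  proof
    assume "S \<inter> translate S g = S"
    then have "S \<subseteq> translate S g" by blast
    then have "translate S g = S" using card_translate[of S g] by (metis card_subset_eq finite)
    then show False using translate_eq_UNIV assms by blast
  qed
  then show "S \<inter> translate S g \<subset> S" by blast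
qed simp

text \<open>Among the pairs \<open>(S, T)\<close> with \<open>X + S\<close> or \<open>- X + S\<close> disjoint from \<open>T\<close>, take \<open>card S + card T\<close>
  largest and then \<open>card S\<close> smallest. For \<open>S' = S + g\<close> and \<open>T' = T + g\<close> the pairs
  \<open>(S \<inter> S', T \<union> T')\<close> and \<open>(S \<union> S', T \<inter> T')\<close> are again of this kind, so that
  two common points of \<open>S\<close> and \<open>S'\<close> would contradict the choice.\<close>

lemma sidon_fragment:
  fixes X S0 T0 :: "'p::prime_card mod_ring set"
  assumes "sum_avoids X S0 T0" "card S0 \<ge> 2" "card T0 \<ge> 2" "X \<noteq> {}"
  obtains X' S T where "X' = X \<or> X' = uminus ` X" "sum_avoids X' S T" "card S \<ge> 2" "card T \<ge> 2"
    "card S0 + card T0 \<le> card S + card T" "sidon S"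
proof -
  define P where "P = (\<lambda>(S, T). card S \<ge> 2 \<and> card T \<ge> 2 \<and> (sum_avoids X S T \<or> sum_avoids (uminus ` X) S T))"
  define sz where "sz = (\<lambda>(S :: 'p mod_ring set, T :: 'p mod_ring set). card S + card T)"
  have P0: "P (S0, T0)" using assms by (simp add: P_def)
  have card_le: "card (S :: 'p mod_ring set) \<le> CARD('p)" for S
    using card_mono[of "UNIV :: 'p mod_ring set" S] by simp
  have "sz y < 2 * CARD('p) + 1" for y
    using card_le[of "fst y"] card_le[of "snd y"] by (auto simp: sz_def split: prod.splits)
  then obtain y where y: "P y" "\<And>z. P z \<Longrightarrow> sz z \<le> sz y"
    using ex_has_greatest_nat[of P "(S0, T0)" sz] P0 by blast
  define P' where "P' = (\<lambda>z. P z \<and> sz z = sz y)"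
  obtain w where w: "P' w" "\<And>z. P' z \<Longrightarrow> card (fst w) \<le> card (fst z)"
    using ex_has_least_nat[of P' y "\<lambda>z. card (fst z)"] y(1) unfolding P'_def by blast
  obtain S T where ST: "w = (S, T)" by (cases w)
  have PST: "P (S, T)" and szy: "sz y = card S + card T" using w(1) ST by (auto simp: P'_def sz_def)
  have max: "card S' + card T' \<le> card S + card T" if "P (S', T')" for S' T'
    using y(2)[OF that] szy by (simp add: sz_def)
  have min: "card S \<le> card S'" if "P (S', T')" "card S' + card T' = card S + card T" for S' T'
    using w(2)[of "(S', T')"] that szy ST by (simp add: P'_def sz_def)
  obtain X' where X': "X' = X \<or> X' = uminus ` X" "sum_avoids X' S T"
    using PST unfolding P_def by auto
  have XX: "uminus ` uminus ` X = X" by (auto simp: image_image)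
  have P_I: "P (S', T')" if "sum_avoids X' S' T'" "card S' \<ge> 2" "card T' \<ge> 2" for S' T'
    using that X'(1) by (auto simp: P_def)
  have c2: "card S \<ge> 2" "card T \<ge> 2" using PST by (auto simp: P_def)
  \<comment> \<open>The dual pair has the same total, so it competes in the minimal choice of
    \<open>card S\<close>.\<close>
  have "P (T, S)" using sum_avoids_dual[OF X'(2)] X'(1) c2 XX by (auto simp: P_def)
  then have ST_le: "card S \<le> card T" using min by simp
  have Sne: "S \<noteq> {}" and Tne: "T \<noteq> {}" using c2 by auto
  have SU: "S \<noteq> UNIV"
  proof
    assume "S = UNIV"
    moreover obtain x where "x \<in> X'" using X'(1) assms(4) by auto
    moreover obtain t where "t \<in> T" using Tne by blast
    ultimately show False using X'(2) unfolding sum_avoids_def by (metis UNIV_I add.commute diff_add_cancel)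
  qed
  have "sidon S" unfolding sidon_def
  proof (intro allI impI)
    fix g :: "'p mod_ring" assume g: "g \<noteq> 0"
    define S' where "S' = translate S g"
    define T' where "T' = translate T g"
    have av: "sum_avoids X' S' T'" unfolding S'_def T'_def by (rule sum_avoids_translate[OF X'(2)])
    have card': "card S' = card S" "card T' = card T" by (simp_all add: S'_def T'_def)
    show "card (S \<inter> translate S g) \<le> 1"
    proof (rule ccontr)
      assume "\<not> card (S \<inter> translate S g) \<le> 1"
      then have i2: "card (S \<inter> S') \<ge> 2" by (simp add: S'_def)
      have lt: "card (S \<inter> S') < card S" unfolding S'_def by (rule card_Int_translate_less[OF g Sne SU])
      have sums: "card S + card S = card (S \<union> S') + card (S \<inter> S')"
        "card T + card T = card (T \<union> T') + card (T \<inter> T')"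
        using card_Un_Int[of S S'] card_Un_Int[of T T'] card' by simp_all
      have u2: "card (T \<union> T') \<ge> 2" "card (S \<union> S') \<ge> 2"
        using sums c2 lt card_mono[of T "T \<inter> T'"] by auto
      have "P (S \<inter> S', T \<union> T')"
        by (rule P_I) (use X'(2) av i2 u2 in \<open>auto simp: sum_avoids_def\<close>)
      then have 1: "card (S \<inter> S') + card (T \<union> T') < card S + card T"
        using max min lt by (metis leD le_neq_implies_less)
      have 2: "card (T \<inter> T') \<le> 1"
      proof (rule ccontr)
        assume "\<not> card (T \<inter> T') \<le> 1"
        then have "P (S \<union> S', T \<inter> T')"
          by (intro P_I) (use X'(2) av u2 in \<open>auto simp: sum_avoids_def\<close>)
        then have "card (S \<union> S') + card (T \<inter> T') \<le> card S + card T" by (rule max)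
        then show False using 1 sums by linarith
      qed
      \<comment> \<open>By 1 and 2, \<open>2 * card T + 1 < card S + card T\<close>, against
        \<open>card S \<le> card T\<close>.\<close>
      show False using 1 2 sums ST_le i2 by linarith
    qed
  qed
  moreover have "card S0 + card T0 \<le> card S + card T" using max[OF P0] .
  ultimately show thesis using that X' c2 by blast
qed

lemma sidon_translates_Int:
  assumes "sidon S" "u \<noteq> v"
  shows "card (translate S u \<inter> translate S v) \<le> 1"
proof -
  have "translate S u \<inter> translate S v = translate (S \<inter> translate S (v - u)) u"
    by (auto simp: algebra_simps)
  then show ?thesis using assms unfolding sidon_def by (metis card_translate eq_iff_diff_eq_0)
qed

lemma sidon_two_translates:
  fixes S :: "'p::prime_card mod_ring set"
  assumes "sidon S" "u \<noteq> v"
  shows "2 * card S \<le> card (translate S u \<union> translate S v) + 1"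
  using card_Un_Int[of "translate S u" "translate S v"] sidon_translates_Int[OF assms] by simp

lemma sidon_three_translates:
  fixes S :: "'p::prime_card mod_ring set"
  assumes "sidon S" "u \<noteq> v" "u \<noteq> w" "v \<noteq> w"
  shows "3 * card S \<le> card (translate S u \<union> translate S v \<union> translate S w) + 3"
proof -
  let ?A = "translate S u \<union> translate S v"
  have "card (?A \<inter> translate S w) \<le> card (translate S u \<inter> translate S w) + card (translate S v \<inter> translate S w)"
    unfolding Int_Un_distrib2 by (rule card_Un_le)
  also have "\<dots> \<le> 2" using sidon_translates_Int[OF assms(1)] assms(3,4) by (metis add_mono one_add_one)
  finally show ?thesis
    using card_Un_Int[of ?A "translate S w"] sidon_two_translates[OF assms(1,2)] by simp
qed

lemma sidon_uminus:
  fixes S :: "'p::prime_card mod_ring set"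
  assumes "sidon S"
  shows "sidon (uminus ` S)"
  unfolding sidon_def
proof (intro allI impI)
  fix g :: "'p mod_ring" assume g: "g \<noteq> 0"
  have "uminus ` S \<inter> translate (uminus ` S) g = uminus ` (S \<inter> translate S (- g))"
    by (auto simp: algebra_simps)
  then show "card (uminus ` S \<inter> translate (uminus ` S) g) \<le> 1"
    using assms g unfolding sidon_def by simp
qed

lemma three_elements:
  assumes "card U \<ge> 3"
  obtains u v w where "u \<in> U" "v \<in> U" "w \<in> U" "u \<noteq> v" "u \<noteq> w" "v \<noteq> w"
proof -
  obtain U0 where "U0 \<subseteq> U" "card U0 = 3" using obtain_subset_with_card_n[OF assms] by blast
  then obtain u v w where "U0 = {u, v, w}" "u \<noteq> v" "v \<noteq> w" "u \<noteq> w" unfolding card_3_iff by blast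
  then show thesis using that[of u v w] \<open>U0 \<subseteq> U\<close> by simp
qed

lemma sidon_three_sum:
  fixes S :: "'p::prime_card mod_ring set"
  assumes "sidon S" "sum_avoids U S V" "card U \<ge> 3"
  shows "3 * card S + card V \<le> CARD('p) + 3"
proof -
  obtain u v w where u: "u \<in> U" "v \<in> U" "w \<in> U" "u \<noteq> v" "u \<noteq> w" "v \<noteq> w"
    by (rule three_elements[OF assms(3)])
  have "(translate S u \<union> translate S v \<union> translate S w) \<inter> V = {}"
    using sum_avoids_disjoint[OF assms(2)] u(1-3) by blast
  from card_disjoint_le[OF this] show ?thesis
    using sidon_three_translates[OF assms(1) u(4-6)] by linarith
qed

text \<open>The fragment method is applied again, with \<open>S\<close> as the fixed set and
  \<open>(X, T)\<close> as the pair, and gives a Sidon set \<open>U\<close>. If \<open>U\<close> has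
  at least three elements, counting three translates both ways yields
  \<open>2 * card S \<le> card U + 3\<close> and \<open>2 * card U \<le> card S + 3\<close>; if it
  has two, two translates suffice.\<close>

lemma sidon_fragment_card:
  fixes S :: "'p::prime_card mod_ring set"
  assumes "sidon S" "sum_avoids X S T" "card X \<ge> 2" "card S \<ge> 2" "card T \<ge> 2"
    "CARD('p) \<le> card X + card S + card T"
  shows "card S \<le> 3"
proof -
  have "sum_avoids S X T" "S \<noteq> {}" using assms(2,4) sum_avoids_commute by auto
  then obtain S' U V where S': "S' = S \<or> S' = uminus ` S" and UV: "sum_avoids S' U V" "card U \<ge> 2"
    "card V \<ge> 2" "card X + card T \<le> card U + card V" "sidon U"
    using sidon_fragment[of S X T] assms(3,5) by metis
  have sS': "sidon S'" "card S' = card S" using S' assms(1) sidon_uminus by auto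
  have VU: "sum_avoids U S' V" using UV(1) sum_avoids_commute by blast
  have tot: "CARD('p) \<le> card U + card S + card V" using UV(4) assms(6) by simp
  show ?thesis
  proof (rule ccontr)
    assume "\<not> card S \<le> 3"
    then have m4: "card S \<ge> 4" by simp
    show False
    proof (cases "card U \<ge> 3")
      case True
      have "3 * card S + card V \<le> CARD('p) + 3" using sidon_three_sum[OF sS'(1) VU True] sS'(2) by simp
      moreover have "3 * card U + card V \<le> CARD('p) + 3"
        by (rule sidon_three_sum[OF UV(5,1)]) (use sS' m4 in simp)
      ultimately show False using tot m4 True by linarith
    next
      case False
      then have "card U = 2" using UV(2) by simp
      then obtain u v where u: "U = {u, v}" "u \<noteq> v" by (auto simp: card_2_iff)
      have "(translate S' u \<union> translate S' v) \<inter> V = {}"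
        using sum_avoids_disjoint[OF VU] u by blast
      then show False
        using card_disjoint_le[of "translate S' u \<union> translate S' v" V] sidon_two_translates[OF sS'(1) u(2)] sS'(2) tot m4 \<open>card U = 2\<close>
        by linarith
    qed
  qed
qed

text \<open>The counting behind a fragment \<open>{0, x, y}\<close>: the hypothesis passes from \<open>(A, E)\<close> to
  \<open>(A \<inter> (A + x), E \<inter> (E + x))\<close>, which strips one point off each run of \<open>A\<close> and of \<open>E\<close>.\<close>

lemma erosion_card:
  fixes A E :: "'p::prime_card mod_ring set"
  assumes "translate A y = (A \<inter> translate A x) \<union> E" "(A \<inter> translate A x) \<inter> E = {}"
    and "A \<inter> translate A x \<subseteq> H" "E \<inter> translate H x = {}" "translate E x \<inter> H = {}"
    and x: "x \<noteq> 0" and "A \<noteq> UNIV" "E \<noteq> UNIV"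
  shows "2 * card A \<le> card E * (card E + 1)"
  using assms(1-5,7,8)
proof (induction "card E" arbitrary: A E rule: less_induct)
  case less
  define A' where "A' = A \<inter> translate A x"
  define E' where "E' = E \<inter> translate E x"
  note h = less.prems[folded A'_def]
  have cA: "card A = card A' + card E"
    using card_Un_disjoint[of A' E] h(1,2) card_translate[of A y] by simp
  show ?case
  proof (cases "E = {}")
    case True
    have "A = {}"
    proof (rule ccontr)
      assume "A \<noteq> {}"
      then have "card A' < card A" unfolding A'_def by (rule card_Int_translate_less[OF x _ h(6)])
      then show False using cA True by simp
    qed
    then show ?thesis by simp
  next
    case False
    have E'lt: "card E' < card E" unfolding E'_def by (rule card_Int_translate_less[OF x False h(7)])
    have "translate A' y = translate A y \<inter> translate (translate A y) x"
      unfolding A'_def by (auto simp: algebra_simps)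
    also have "\<dots> = (A' \<union> E) \<inter> (translate A' x \<union> translate E x)"
      unfolding h(1) by auto
    \<comment> \<open>The mixed intersections are empty: \<open>H\<close> contains \<open>A'\<close>
      and misses the translate of \<open>E\<close>, while \<open>E\<close> misses the translate of
      \<open>H\<close>.\<close>
    also have "\<dots> = (A' \<inter> translate A' x) \<union> E'"
    proof -
      have "A' \<inter> translate E x = {}" using h(3,5) by blast
      moreover have "translate A' x \<subseteq> translate H x" using h(3) by auto
      then have "E \<inter> translate A' x = {}" using h(4) by blast
      ultimately show ?thesis unfolding E'_def by blast
    qed
    finally have 1: "translate A' y = (A' \<inter> translate A' x) \<union> E'" .
    have "translate E' x \<subseteq> translate E x" unfolding E'_def by auto
    then have 5: "translate E' x \<inter> H = {}" using h(5) by blast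
    have "2 * card A' \<le> card E' * (card E' + 1)"
      by (rule less.hyps[OF E'lt 1 _ _ _ 5])
        (use h(2-4,6,7) in \<open>auto simp: A'_def E'_def\<close>)
    also have "\<dots> \<le> (card E - 1) * (card E - 1 + 1)" by (intro mult_mono) (use E'lt in auto)
    finally have "2 * card A' \<le> (card E - 1) * (card E - 1 + 1)" .
    \<comment> \<open>One erosion costs \<open>A\<close> exactly \<open>card E\<close> points and
      shrinks \<open>E\<close>, so the bound is a triangular number.\<close>
    then have "2 * card A \<le> (card E - 1) * (card E - 1 + 1) + 2 * card E" using cA by simp
    also have "\<dots> = card E * (card E + 1)" using E'lt by (cases "card E") auto
    finally show ?thesis .
  qed
qed

text \<open>\<open>E\<close> consists of the three points of the translate by \<open>y\<close>
  outside \<open>H\<close>, so \<open>erosion_card\<close> bounds \<open>2 * card G\<close> by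
  \<open>3 * 4\<close>.\<close>

lemma triple_fragment_card:
  fixes G :: "'p::prime_card mod_ring set"
  assumes "G \<inter> translate G x = H" "G \<inter> translate G y = H" "translate G x \<inter> translate G y = H"
    and "card G = card H + 3" "x \<noteq> 0" "G \<noteq> UNIV"
  shows "card G \<le> 6"
proof -
  define E where "E = translate G y - H"
  have HG: "H \<subseteq> translate G y" using assms(2) by blast
  have "card E = 3" using card_Diff_subset[OF _ HG] assms(4) by (simp add: E_def)
  moreover have "2 * card G \<le> card E * (card E + 1)"
  proof (rule erosion_card[where H = H])
    show "translate G y = (G \<inter> translate G x) \<union> E" "(G \<inter> translate G x) \<inter> E = {}" "G \<inter> translate G x \<subseteq> H"
      using HG assms(1) by (auto simp: E_def)
    have "e \<notin> translate H x" if "e \<in> E" for e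
    proof
      assume "e \<in> translate H x"
      then have "e \<in> translate G x" using assms(1) by auto
      then show False using that assms(3) by (auto simp: E_def)
    qed
    then show "E \<inter> translate H x = {}" by blast
    have "e \<notin> H" if "e \<in> translate E x" for e
    proof
      assume "e \<in> H"
      then have "e - x \<in> G" using assms(1) by auto
      then show False using that assms(2) by (auto simp: E_def)
    qed
    then show "translate E x \<inter> H = {}" by blast
    show "E \<noteq> UNIV"
    proof
      assume "E = UNIV"
      then have "translate G y = UNIV" by (auto simp: E_def)
      then have "G = UNIV" using card_translate[of G y] by (metis card_subset_eq finite subset_UNIV)
      then show False using assms(6) by blast
    qed
  qed (use assms in auto)
  ultimately show ?thesis by simp
qed

text \<open>The translate adds exactly the points reached by a step out of \<open>X\<close>, so the
  union measures the number of blocks.\<close>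

lemma card_Un_translate:
  fixes X :: "'p::prime_card mod_ring set"
  shows "card (X \<union> translate X e) = card X + card (steps e X (- X))"
proof -
  have "translate (steps e X (- X)) e = translate X e - X" by auto
  then have "card (steps e X (- X)) = card (translate X e - X)" using card_translate by metis
  moreover have "card (X \<union> (translate X e - X)) = card X + card (translate X e - X)"
    by (rule card_Un_disjoint) auto
  ultimately show ?thesis by simp
qed

lemma card_steps_uminus_image:
  fixes X :: "'p::prime_card mod_ring set"
  shows "card (steps e (uminus ` X) (- (uminus ` X))) = card (steps e X (- X))"
proof -
  have "steps e (uminus ` X) (- (uminus ` X)) = uminus ` (steps (- e) X (- X))" by auto
  then have "card (steps e (uminus ` X) (- (uminus ` X))) = card (steps (- e) X (- X))" by simp
  then show ?thesis by (simp add: steps_uminus card_steps_compl)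
qed

text \<open>If every nonzero difference gave at least three blocks, two distinct translates would
  cover at least \<open>card X + 3\<close> points. The Sidon fragment, of at most three points, then
  has exactly three, and any two of its translates leave out exactly \<open>T\<close>. This bounds
  the complement of \<open>X\<close> by six.\<close>

lemma few_components:
  fixes X :: "'p::prime_card mod_ring set"
  assumes av: "sum_avoids X S0 T0" and big: "card X \<ge> 2" "card S0 \<ge> 2" "card T0 \<ge> 2"
    and tot: "CARD('p) \<le> card X + card S0 + card T0" and small: "card X + 7 \<le> CARD('p)"
  shows "\<exists>e. e \<noteq> 0 \<and> card (steps e X (- X)) \<le> 2"
proof (rule ccontr)
  assume neg: "\<not> ?thesis"
  have many: "card (steps e X (- X)) \<ge> 3" if "e \<noteq> 0" for e
  proof (rule ccontr)
    assume "\<not> card (steps e X (- X)) \<ge> 3"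
    then have "card (steps e X (- X)) \<le> 2" by simp
    then show False using \<open>e \<noteq> 0\<close> neg by blast
  qed
  have "X \<noteq> {}" using big by auto
  then obtain X' S T where X': "X' = X \<or> X' = uminus ` X" and ST: "sum_avoids X' S T" "card S \<ge> 2"
    "card T \<ge> 2" "card S0 + card T0 \<le> card S + card T" "sidon S"
    using sidon_fragment[OF av big(2,3)] by metis
  have cX': "card X' = card X" using X' by auto
  have tot': "CARD('p) \<le> card X' + card S + card T" using ST(4) tot cX' by simp
  have card3: "card S \<le> 3" by (rule sidon_fragment_card[OF ST(5,1) _ ST(2,3) tot']) (use big cX' in simp)
  have many': "card (X' \<union> translate X' e) \<ge> card X + 3" if "e \<noteq> 0" for e
    using many[OF that] X' card_Un_translate[of X' e] cX' card_steps_uminus_image[of e X] by auto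
  have dis: "translate X' s \<inter> T = {}" if "s \<in> S" for s
    using sum_avoids_disjoint ST(1) that sum_avoids_commute by blast
  have tr2: "translate X' u \<union> translate X' v = translate (X' \<union> translate X' (v - u)) u" for u v
    by (auto simp: algebra_simps)
  have un: "card (translate X' u \<union> translate X' v) \<ge> card X + 3" if "u \<noteq> v" for u v
    unfolding tr2 card_translate by (rule many') (use that in auto)
  obtain u v where uv: "u \<in> S" "v \<in> S" "u \<noteq> v"
    using ST(2) by (metis card_le_Suc0_iff_eq finite not_less_eq_eq numeral_2_eq_2)
  have "card (translate X' u \<union> translate X' v) + card T \<le> CARD('p)"
    by (rule card_disjoint_le) (use dis uv in blast)
  then have "card S = 3" using un[OF uv(3)] tot' cX' card3 by linarith
  then obtain s0 s1 s2 where S: "S = {s0, s1, s2}" "s0 \<noteq> s1" "s1 \<noteq> s2" "s0 \<noteq> s2"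
    unfolding card_3_iff by blast
  have compl: "- (translate X' u \<union> translate X' v) = T" if uv: "u \<in> S" "v \<in> S" "u \<noteq> v" for u v
  proof (rule sym, rule card_subset_eq)
    show "T \<subseteq> - (translate X' u \<union> translate X' v)" using dis uv by blast
    then have "card T \<le> card (- (translate X' u \<union> translate X' v))" by (rule card_mono[rotated]) simp
    moreover have "card (- (translate X' u \<union> translate X' v)) = CARD('p) - card (translate X' u \<union> translate X' v)"
      by (rule card_compl)
    ultimately show "card T = card (- (translate X' u \<union> translate X' v))"
      using un[OF uv(3)] tot' cX' \<open>card S = 3\<close> by linarith
  qed simp
  \<comment> \<open>Complements turn the three translates into \<open>G\<close> and two shifts of
    it, whose pairwise intersections are all \<open>T\<close>.\<close>
  define G where "G = - translate X' s0"
  have tG: "translate G (s - s0) = - translate X' s" for s by (auto simp: G_def algebra_simps)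
  have cG: "card G = CARD('p) - card X" unfolding G_def using cX' by (simp add: card_compl)
  have "card T + (card X + 3) \<le> CARD('p)"
    using un[OF uv(3)] \<open>card (translate X' u \<union> translate X' v) + card T \<le> CARD('p)\<close> by linarith
  then have "card G = card T + 3" using cG tot' cX' \<open>card S = 3\<close> by linarith
  moreover have "G \<noteq> UNIV"
  proof
    assume "G = UNIV"
    then show False using cG big(1) small by simp
  qed
  ultimately have "card G \<le> 6"
    using triple_fragment_card[of G "s1 - s0" T "s2 - s0"] tG compl S
    by (auto simp: G_def)
  then show False using cG small by linarith
qed

section \<open>Classes with three elements\<close>

lemma ap_2: "ap d x 2 = {x, x + d}"
  by (auto simp: ap_def lessThan_Suc numeral_2_eq_2)

lemma ap_3: "ap d x 3 = {x, x + d, x + 2 * d}"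
  by (auto simp: ap_def lessThan_Suc numeral_3_eq_3)

lemma is_ap_card_2:
  assumes "card X = 2"
  shows "is_ap X"
proof -
  obtain u v where "X = {u, v}" "u \<noteq> v" using assms by (auto simp: card_2_iff)
  then have "X = ap (v - u) u 2" "v - u \<noteq> 0" by (auto simp: ap_2)
  then show ?thesis unfolding is_ap_def by blast
qed

text \<open>The last three conditions say that \<open>x\<close>, \<open>y\<close> and 0,
  respectively, is not the midpoint of the other two.\<close>

definition not_ap3 :: "'p::prime_card mod_ring \<Rightarrow> 'p mod_ring \<Rightarrow> bool" where
  "not_ap3 x y \<longleftrightarrow> x \<noteq> 0 \<and> y \<noteq> 0 \<and> x \<noteq> y \<and> y \<noteq> 2 * x \<and> x \<noteq> 2 * y \<and> x \<noteq> - y"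

lemma three_set_not_ap:
  assumes "card X = 3" "\<not> is_ap X"
  obtains u x y where "X = {u, u + x, u + y}" "not_ap3 x y"
proof -
  obtain u v w where X: "X = {u, v, w}" "u \<noteq> v" "v \<noteq> w" "u \<noteq> w" using assms(1) unfolding card_3_iff by blast
  define x where "x = v - u"
  define y where "y = w - u"
  have v: "v = u + x" "w = u + y" by (simp_all add: x_def y_def)
  have n: "X \<noteq> ap d z 3" if "d \<noteq> 0" for d z using assms(2) that unfolding is_ap_def by blast
  have ne: "x \<noteq> 0" "y \<noteq> 0" "x \<noteq> y" using X v by auto
  moreover have "y \<noteq> 2 * x" using n[OF ne(1), of u] X v by (auto simp: ap_3)
  moreover have "x \<noteq> 2 * y" using n[OF ne(2), of u] X v by (auto simp: ap_3 insert_commute)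
  moreover have "x \<noteq> - y"
  proof
    assume "x = - y"
    then have "X = ap x (u + y) 3" unfolding X v ap_3 by auto
    then show False using n[OF ne(1)] by blast
  qed
  ultimately show thesis using that[of u x y] X v by (simp add: not_ap3_def)
qed

text \<open>Reduces the equivalences of linear equations below to ring identities that normalization
  checks.\<close>

lemma ring_eq_iff:
  fixes a b c d :: "'a::comm_ring_1"
  assumes "a - b = c - d \<or> a - b = d - c"
  shows "a = b \<longleftrightarrow> c = d"
  using assms by (metis eq_iff_diff_eq_0)

text \<open>Two representations of \<open>g\<close> as a difference involve \<open>a\<close>,
  \<open>b\<close>, \<open>a - g\<close>, \<open>b - g\<close>. In a set of three points two of
  these coincide, which yields a progression of difference \<open>g\<close>.\<close>

lemma not_ap_sidon:
  fixes X :: "'p::prime_card mod_ring set"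
  assumes "card X = 3" "\<not> is_ap X" and p3: "CARD('p) > 3"
  shows "sidon X"
  unfolding sidon_def
proof (intro allI impI, rule ccontr)
  fix g :: "'p mod_ring" assume g: "g \<noteq> 0" and "\<not> card (X \<inter> translate X g) \<le> 1"
  then obtain a b where ab: "a \<in> X" "b \<in> X" "a - g \<in> X" "b - g \<in> X" "a \<noteq> b"
  proof -
    obtain a b where "a \<in> X \<inter> translate X g" "b \<in> X \<inter> translate X g" "a \<noteq> b"
      using card_le_Suc0_iff_eq[of "X \<inter> translate X g"] \<open>\<not> card (X \<inter> translate X g) \<le> 1\<close> by auto
    then show thesis using that[of a b] by simp
  qed
  have g2: "2 * g \<noteq> 0" using mod_ring_2_3_neq_0[OF p3] g by simp
  have ap: False if "c \<in> X" "c + g \<in> X" "c + 2 * g \<in> X" for c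
  proof -
    have "(c + 2 * g) - c = 2 * g" "(c + 2 * g) - (c + g) = g" "(c + g) - c = g"
      by (simp_all add: algebra_simps)
    then have ne: "c \<noteq> c + 2 * g" "c + g \<noteq> c + 2 * g" "c \<noteq> c + g"
      using g g2 by (metis diff_self)+
    then have "card (ap g c 3) = 3" unfolding ap_3 by simp
    moreover have "ap g c 3 \<subseteq> X" unfolding ap_3 using that by simp
    ultimately have "ap g c 3 = X" using assms(1) by (metis card_subset_eq finite)
    then show False using assms(2) g unfolding is_ap_def by blast
  qed
  have "b \<noteq> a + g" using ap[of "a - g"] ab by (auto simp: algebra_simps)
  moreover have "a \<noteq> b + g" using ap[of "b - g"] ab by (auto simp: algebra_simps)
  ultimately have "card {a, b, a - g, b - g} = 4" using ab g by (auto simp: eq_diff_eq diff_eq_eq)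
  moreover have "card {a, b, a - g, b - g} \<le> card X" by (rule card_mono) (use ab in auto)
  ultimately show False using assms(1) by simp
qed

text \<open>The four alternatives say that \<open>{0, x, y}\<close> is the image of \<open>{0, 1, 3}\<close> under an affine map
  that sends \<open>0\<close> or \<open>1\<close> to \<open>0\<close>. They come from a translate of \<open>- X\<close> that is contained in
  \<open>X + X\<close> and contains the double of the base point.\<close>

lemma double_in_reflection:
  fixes x y :: "'p::prime_card mod_ring"
  assumes na: "not_ap3 x y" and p3: "CARD('p) > 3"
    and sub: "\<And>v. v \<in> X \<union> translate X t \<Longrightarrow> \<exists>a\<in>X. \<exists>a'\<in>X. v + a + a' + t = b"
    and X: "X = {u, u + x, u + y}" and v: "v \<in> X \<union> translate X t" "v + 2 * u + t = b"
  shows "x = 3 * y \<or> y = 3 * x \<or> x = - 2 * y \<or> y = - 2 * x"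
proof -
  have h: "x \<noteq> 0" "y \<noteq> 0" "x \<noteq> y" "y \<noteq> 2 * x" "x \<noteq> 2 * y" "x \<noteq> - y"
    using na by (auto simp: not_ap3_def)
  have two: "2 * x \<noteq> 0" "2 * y \<noteq> 0" "3 * x \<noteq> 0" "3 * y \<noteq> 0" using h mod_ring_2_3_neq_0[OF p3] by auto
  \<comment> \<open>\<open>c\<close> is the base point of the copy of \<open>X\<close> that contains
    \<open>v\<close>.\<close>
  obtain c where c: "v = c \<or> v = c + x \<or> v = c + y"
    "c \<in> X \<union> translate X t" "c + x \<in> X \<union> translate X t" "c + y \<in> X \<union> translate X t"
  proof (cases "v \<in> X")
    case True
    then show thesis using that[of u] X by auto
  next
    case False
    then have "v - t \<in> X" using v by simp
    then have "v - t = u \<or> v - t = u + x \<or> v - t = u + y" using X by simp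
    then have "v = u + t \<or> v = u + t + x \<or> v = u + t + y" by (auto simp: diff_eq_eq ac_simps)
    moreover have "u + t + x - t = u + x" "u + t + y - t = u + y" "u + t - t = u" by simp_all
    ultimately show thesis using that[of "u + t"] X by simp
  qed
  \<comment> \<open>The sumset of \<open>{0, x, y}\<close> with itself. As \<open>v\<close> is the
    mirror image of the double of \<open>u\<close>, its differences to the points of its copy all
    lie in \<open>D\<close>.\<close>
  define D where "D = {0, x, y, 2 * x, 2 * y, x + y}"
  have dD: "v - (c + e) \<in> D" if e: "c + e \<in> X \<union> translate X t" for e
  proof -
    obtain a a' where a: "a \<in> X" "a' \<in> X" "c + e + a + a' + t = b" using sub[OF e] by blast
    have "v - (c + e) = (a - u) + (a' - u)"
    proof -
      have "v - (c + e) - ((a - u) + (a' - u)) = (v + 2 * u + t) - (c + e + a + a' + t)"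
        by (simp add: algebra_simps)
      also have "\<dots> = 0" unfolding a(3) v(2) by simp
      finally show ?thesis by simp
    qed
    moreover have "a - u \<in> {0, x, y}" "a' - u \<in> {0, x, y}" using a(1,2) X by auto
    ultimately show ?thesis unfolding D_def by auto
  qed
  have D: "v - c \<in> D" "v - (c + x) \<in> D" "v - (c + y) \<in> D" using dD[of 0] dD[of x] dD[of y] c by auto
  have tr: "- x = 2 * x \<longleftrightarrow> 3 * x = 0" "- x = x \<longleftrightarrow> 2 * x = 0" "x - y = x + y \<longleftrightarrow> 2 * y = 0"
    "y - x = x + y \<longleftrightarrow> 2 * x = 0" "- x = y \<longleftrightarrow> x = - y" "x - y = y \<longleftrightarrow> x = 2 * y" "y - x = x \<longleftrightarrow> y = 2 * x"
    "x - y = 2 * x \<longleftrightarrow> x = - y" "y - x = 2 * y \<longleftrightarrow> x = - y" "x - y = 2 * y \<longleftrightarrow> x = 3 * y"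
    "y - x = 2 * x \<longleftrightarrow> y = 3 * x" "- x = 2 * y \<longleftrightarrow> x = - 2 * y" "- x = x + y \<longleftrightarrow> y = - 2 * x"
    by (rule ring_eq_iff, simp add: algebra_simps)+
  from c(1) show ?thesis
  proof (elim disjE)
    assume "v = c"
    then have "- x \<in> D" using D(2) by simp
    then show ?thesis using h two unfolding D_def insert_iff tr by simp
  next
    assume "v = c + x"
    then have "x - y \<in> D" using D(3) by (simp add: algebra_simps)
    then show ?thesis using h two unfolding D_def insert_iff tr by simp
  next
    assume "v = c + y"
    then have "y - x \<in> D" using D(2) by (simp add: algebra_simps)
    then show ?thesis using h two unfolding D_def insert_iff tr by simp
  qed
qed

text \<open>The second alternative is the reflected shape, since \<open>x - {0, x, y}\<close> is
  \<open>{x, 0, x - y}\<close>. Fixing a pair at distance \<open>x\<close>, the other two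
  differences determine the third point.\<close>

lemma three_set_structure:
  fixes x y :: "'p::prime_card mod_ring"
  assumes na: "not_ap3 x y" and p3: "CARD('p) > 3" and Y: "card Y = 3"
    and diff: "\<exists>v\<in>Y. v + x \<in> Y" "\<exists>v\<in>Y. v + y \<in> Y" "\<exists>v\<in>Y. v + (y - x) \<in> Y"
  shows "\<exists>s. Y = {s, s + x, s + y} \<or> Y = {s, s + x, s + x - y}"
proof -
  have h: "x \<noteq> 0" "y \<noteq> 0" "x \<noteq> y" "y \<noteq> 2 * x" "x \<noteq> 2 * y" "x \<noteq> - y"
    using na by (auto simp: not_ap3_def)
  have two: "2 * x \<noteq> 0" "2 * y \<noteq> 0" using h mod_ring_2_3_neq_0[OF p3] by auto
  obtain s where s: "s \<in> Y" "s + x \<in> Y" using diff(1) by blast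
  have "card (Y - {s, s + x}) = 1" using s h Y by (simp add: card_Diff_subset)
  then obtain r where r: "Y - {s, s + x} = {r}" by (auto simp: card_1_singleton_iff)
  define w where "w = r - s"
  have Yw: "Y = {s, s + x, s + w}" using r s by (auto simp: w_def)
  define \<Delta> where "\<Delta> = {0, x, - x, w, - w, w - x, x - w}"
  have in\<Delta>: "z \<in> \<Delta>" if z: "\<exists>v\<in>Y. v + z \<in> Y" for z
  proof -
    obtain v v' where v: "v \<in> Y" "v' \<in> Y" "v + z = v'" using z by blast
    have "z = (v' - s) - (v - s)" using v(3) by (simp add: algebra_simps)
    moreover have "a - s \<in> {0, x, w}" if "a \<in> Y" for a
    proof -
      have "a = s \<or> a = s + x \<or> a = s + w" using that unfolding Yw by simp
      then show ?thesis by (elim disjE) simp_all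
    qed
    then have "v - s \<in> {0, x, w}" "v' - s \<in> {0, x, w}" using v by simp_all
    ultimately show ?thesis unfolding \<Delta>_def by auto
  qed
  have "y \<in> \<Delta>" "y - x \<in> \<Delta>" using in\<Delta> diff by auto
  moreover have "y = w - x \<longleftrightarrow> w = x + y" "y = x - w \<longleftrightarrow> w = x - y" "y = - w \<longleftrightarrow> w = - y" "y = - x \<longleftrightarrow> x = - y"
    by (rule ring_eq_iff, simp add: algebra_simps)+
  then have "y \<in> \<Delta> \<longleftrightarrow> y = 0 \<or> y = x \<or> x = - y \<or> y = w \<or> w = - y \<or> w = x + y \<or> w = x - y"
    unfolding \<Delta>_def by simp
  \<comment> \<open>The values \<open>- y\<close> and \<open>x + y\<close> of \<open>w\<close> do
    provide the difference \<open>y\<close>; it is \<open>y - x\<close> that rules them out.\<close>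
  ultimately consider "y = w" | "w = x - y" | "w = - y" "y - x \<in> \<Delta>" | "w = x + y" "y - x \<in> \<Delta>"
    using h(2,3,6) by metis
  then show ?thesis
  proof cases
    case 1 then show ?thesis using Yw by blast
  next
    case 2 then show ?thesis using Yw by (auto simp: add_diff_eq)
  next
    case 3
    have tr: "y - x = x \<longleftrightarrow> y = 2 * x" "y - x = - y \<longleftrightarrow> x = 2 * y"
      "y - x = - y - x \<longleftrightarrow> 2 * y = 0" "y - x = x - - y \<longleftrightarrow> 2 * x = 0" by (rule ring_eq_iff, simp add: algebra_simps)+
    show ?thesis using 3(2) h two unfolding \<Delta>_def 3(1) insert_iff tr by simp
  next
    case 4
    have tr: "y - x = x \<longleftrightarrow> y = 2 * x" "y - x = x + y \<longleftrightarrow> 2 * x = 0"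
      "y - x = - (x + y) \<longleftrightarrow> 2 * y = 0" "y - x = x + y - x \<longleftrightarrow> x = 0" "y - x = x - (x + y) \<longleftrightarrow> x = 2 * y"
      by (rule ring_eq_iff, simp add: algebra_simps)+
    show ?thesis using 4(2) h two unfolding \<Delta>_def 4(1) insert_iff tr by simp
  qed
qed

text \<open>The hypotheses are the alternatives above for the three choices of base point in \<open>X\<close>.\<close>

lemma affine_contradiction:
  fixes x y :: "'p::prime_card mod_ring"
  assumes p: "CARD('p) > 8" and nz: "x \<noteq> 0" "y \<noteq> 0"
    and 0: "x = 3 * y \<or> y = 3 * x \<or> x = - 2 * y \<or> y = - 2 * x"
    and 1: "- x = 3 * (y - x) \<or> y - x = 3 * (- x) \<or> - x = - 2 * (y - x) \<or> y - x = - 2 * (- x)"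
    and 2: "- y = 3 * (x - y) \<or> x - y = 3 * (- y) \<or> - y = - 2 * (x - y) \<or> x - y = - 2 * (- y)"
  shows False
proof -
  have "(of_nat n :: 'p mod_ring) \<noteq> 0" if "0 < n" "n \<le> 8" for n
    by (rule of_nat_mod_ring_neq_0) (use that p in auto)
  from this[of 2] this[of 3] this[of 5] this[of 7] this[of 8]
  have "(2 :: 'p mod_ring) \<noteq> 0" "(3 :: 'p mod_ring) \<noteq> 0" "(5 :: 'p mod_ring) \<noteq> 0"
    "(7 :: 'p mod_ring) \<noteq> 0" "(8 :: 'p mod_ring) \<noteq> 0"
    unfolding of_nat_numeral by simp_all
  then have n: "2 * z \<noteq> 0" "3 * z \<noteq> 0" "5 * z \<noteq> 0" "7 * z \<noteq> 0" "8 * z \<noteq> 0"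
    if "z \<noteq> 0" for z :: "'p mod_ring"
    using that by (simp_all only: mult_eq_0_iff simp_thms)
  note nx = n[OF nz(1)] and ny = n[OF nz(2)]
  have e1: "- x = 3 * (y - x) \<longleftrightarrow> 2 * x = 3 * y" "y - x = 3 * (- x) \<longleftrightarrow> y = - 2 * x"
    "- x = - 2 * (y - x) \<longleftrightarrow> 3 * x = 2 * y" "y - x = - 2 * (- x) \<longleftrightarrow> y = 3 * x" by (rule ring_eq_iff, simp add: algebra_simps)+
  have e2: "- y = 3 * (x - y) \<longleftrightarrow> 2 * y = 3 * x" "x - y = 3 * (- y) \<longleftrightarrow> x = - 2 * y"
    "- y = - 2 * (x - y) \<longleftrightarrow> 3 * y = 2 * x" "x - y = - 2 * (- y) \<longleftrightarrow> x = 3 * y" by (rule ring_eq_iff, simp add: algebra_simps)+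
  \<comment> \<open>Hypothesis 1 tolerates \<open>y = 3 * x\<close> and \<open>y = - 2 * x\<close>,
    hypothesis 2 tolerates the two others. Each alternative is confronted with the hypothesis
    against it, which makes 3, 7 or 8 times an element vanish.\<close>
  from 0 show False
  proof (elim disjE)
    assume a: "x = 3 * y"
    have tr: "2 * (3 * y) = 3 * y \<longleftrightarrow> 3 * y = 0" "y = - 2 * (3 * y) \<longleftrightarrow> 7 * y = 0"
      "3 * (3 * y) = 2 * y \<longleftrightarrow> 7 * y = 0" "y = 3 * (3 * y) \<longleftrightarrow> 8 * y = 0" by (rule ring_eq_iff, simp add: algebra_simps)+
    then show False using 1[unfolded e1, unfolded a, unfolded tr] ny by blast
  next
    assume a: "x = - 2 * y"
    have tr: "2 * (- 2 * y) = 3 * y \<longleftrightarrow> 7 * y = 0" "y = - 2 * (- 2 * y) \<longleftrightarrow> 3 * y = 0"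
      "3 * (- 2 * y) = 2 * y \<longleftrightarrow> 8 * y = 0" "y = 3 * (- 2 * y) \<longleftrightarrow> 7 * y = 0" by (rule ring_eq_iff, simp add: algebra_simps)+
    then show False using 1[unfolded e1, unfolded a, unfolded tr] ny by blast
  next
    assume a: "y = 3 * x"
    have tr: "2 * (3 * x) = 3 * x \<longleftrightarrow> 3 * x = 0" "x = - 2 * (3 * x) \<longleftrightarrow> 7 * x = 0"
      "3 * (3 * x) = 2 * x \<longleftrightarrow> 7 * x = 0" "x = 3 * (3 * x) \<longleftrightarrow> 8 * x = 0" by (rule ring_eq_iff, simp add: algebra_simps)+
    then show False using 2[unfolded e2, unfolded a, unfolded tr] nx by blast
  next
    assume a: "y = - 2 * x"
    have tr: "2 * (- 2 * x) = 3 * x \<longleftrightarrow> 7 * x = 0" "x = - 2 * (- 2 * x) \<longleftrightarrow> 3 * x = 0"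
      "3 * (- 2 * x) = 2 * x \<longleftrightarrow> 8 * x = 0" "x = 3 * (- 2 * x) \<longleftrightarrow> 7 * x = 0" by (rule ring_eq_iff, simp add: algebra_simps)+
    then show False using 2[unfolded e2, unfolded a, unfolded tr] nx by blast
  qed
qed

text \<open>Moving the base point to \<open>x\<close> and interchanging the other two points
  together reach all three base points.\<close>

lemma not_ap3_rebase: "not_ap3 x y \<Longrightarrow> not_ap3 (- x) (y - x)" "not_ap3 x y \<Longrightarrow> not_ap3 y x"
  unfolding not_ap3_def by (auto simp: algebra_simps)

lemma translates_meet:
  assumes "card (translate Y a \<inter> translate Y c) = 1"
  shows "\<exists>v\<in>Y. v + (c - a) \<in> Y"
proof -
  obtain w where "translate Y a \<inter> translate Y c = {w}" using assms by (rule card_1_singletonE)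
  then have "w - a \<in> Y" "w - c \<in> Y" unfolding set_eq_iff by auto
  moreover have "w - c + (c - a) = w - a" by simp
  ultimately show ?thesis by metis
qed

text \<open>Three translates of the Sidon set \<open>Y\<close> cover at least six points, and
  \<open>R\<close> leaves room for no more. This tightness makes \<open>Y\<close> a translate of
  \<open>X\<close> and the sumset of both the exact mirror image of their union; the doubles of the
  elements of \<open>X\<close> then contradict each other.\<close>

lemma no_two_three_classes:
  fixes X :: "'p::prime_card mod_ring set"
  assumes fc: "free_coloring b X Y Z" and c3: "card X = 3" "card Y = 3"
    and nap: "\<not> is_ap X" "\<not> is_ap Y" and p: "CARD('p) > 8"
  shows False
proof -
  have p3: "CARD('p) > 3" using p by simp
  obtain u x y where X: "X = {u, u + x, u + y}" and na: "not_ap3 x y"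
    using three_set_not_ap[OF c3(1) nap(1)] by blast
  have h: "x \<noteq> 0" "y \<noteq> 0" "x \<noteq> y" using na by (auto simp: not_ap3_def)
  have sid: "sidon Y" by (rule not_ap_sidon[OF c3(2) nap(2) p3])
  let ?A = "translate Y u" and ?B = "translate Y (u + x)" and ?C = "translate Y (u + y)"
  define R where "R = {w. b - w \<in> Z}"
  have cR: "card R = card Z"
  proof -
    have "R = translate (uminus ` Z) b" by (auto simp: R_def)
    then show ?thesis by simp
  qed
  have dis: "(?A \<union> ?B \<union> ?C) \<inter> R = {}"
  proof -
    have no: "w \<notin> R" if "a \<in> X" "w - a \<in> Y" for a w
    proof
      assume "w \<in> R"
      then have "b - w \<in> Z" by (simp add: R_def)
      moreover have "a + (w - a) + (b - w) = b" by simp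
      ultimately show False using fc that unfolding free_coloring_def by blast
    qed
    have "u \<in> X" "u + x \<in> X" "u + y \<in> X" using X by simp_all
    then have "w \<notin> R" if "w - u \<in> Y \<or> w - (u + x) \<in> Y \<or> w - (u + y) \<in> Y" for w
      using no that by blast
    then show ?thesis by auto
  qed
  have tot: "card Z + 6 = CARD('p)" using free_coloring_card[OF fc] c3 by simp
  have le6: "card (?A \<union> ?B \<union> ?C) \<le> 6" using card_disjoint_le[OF dis] cR tot by simp
  have i: "card (?A \<inter> ?B) \<le> 1" "card (?A \<inter> ?C) \<le> 1" "card (?B \<inter> ?C) \<le> 1"
    using sidon_translates_Int[OF sid] h by simp_all
  have ie1: "card (?A \<union> ?B) + card (?A \<inter> ?B) = 6"
    using card_Un_Int[of ?A ?B] c3 by simp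
  have ie2: "card (?A \<union> ?B \<union> ?C) + card ((?A \<union> ?B) \<inter> ?C) = card (?A \<union> ?B) + 3"
    using card_Un_Int[of "?A \<union> ?B" ?C] c3 by simp
  have ie3: "card ((?A \<union> ?B) \<inter> ?C) + card (?A \<inter> ?B \<inter> ?C) = card (?A \<inter> ?C) + card (?B \<inter> ?C)"
  proof -
    have "(?A \<union> ?B) \<inter> ?C = (?A \<inter> ?C) \<union> (?B \<inter> ?C)" "(?A \<inter> ?C) \<inter> (?B \<inter> ?C) = ?A \<inter> ?B \<inter> ?C" by auto
    then show ?thesis using card_Un_Int[of "?A \<inter> ?C" "?B \<inter> ?C"] by simp
  qed
  \<comment> \<open>Nine points with at most three pairwise overlaps in room for six: each pair of
    translates meets once, and no point is in all three.\<close>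
  have one: "card (?A \<inter> ?B) = 1" "card (?A \<inter> ?C) = 1" "card (?B \<inter> ?C) = 1"
    and none: "card (?A \<inter> ?B \<inter> ?C) = 0" and six: "card (?A \<union> ?B \<union> ?C) = 6"
    using le6 i ie1 ie2 ie3 by linarith+
  have "(u + x) - u = x" "(u + y) - u = y" "(u + y) - (u + x) = y - x" by simp_all
  then have diff: "\<exists>v\<in>Y. v + x \<in> Y" "\<exists>v\<in>Y. v + y \<in> Y" "\<exists>v\<in>Y. v + (y - x) \<in> Y"
    using translates_meet[OF one(1)] translates_meet[OF one(2)] translates_meet[OF one(3)] by simp_all
  obtain s where s: "Y = {s, s + x, s + y} \<or> Y = {s, s + x, s + x - y}"
    using three_set_structure[OF na p3 c3(2) diff] by blast
  have "Y \<noteq> {s, s + x, s + x - y}"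
  proof
    assume Y: "Y = {s, s + x, s + x - y}"
    have "u + s + x - u = s + x" "u + s + x - (u + x) = s" "u + s + x - (u + y) = s + x - y" by simp_all
    then have "u + s + x \<in> ?A \<inter> ?B \<inter> ?C" unfolding Y Int_iff mem_translate by simp
    moreover have "?A \<inter> ?B \<inter> ?C = {}" using none by (meson card_0_eq finite)
    ultimately show False by blast
  qed
  then have Y: "Y = {s, s + x, s + y}" using s by blast
  define t where "t = s - u"
  have Yt: "Y = translate X t" unfolding Y X t_def by (auto simp: diff_eq_eq algebra_simps)
  have comp: "?A \<union> ?B \<union> ?C = - R"
  proof (rule card_subset_eq)
    show "?A \<union> ?B \<union> ?C \<subseteq> - R" using dis by blast
    show "card (?A \<union> ?B \<union> ?C) = card (- R)" using six tot by (simp add: card_compl cR)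
  qed simp
  have nm: "- Z = X \<union> Y" using free_coloring_classes(1)[of b Z X Y] fc free_coloring_swap by blast
  have sub: "\<exists>a\<in>X. \<exists>a'\<in>X. v + a + a' + t = b" if v: "v \<in> X \<union> translate X t" for v
  proof -
    have "v \<notin> Z" using v nm Yt by blast
    then have "b - v \<in> - R" by (simp add: R_def)
    then have "b - v \<in> ?A \<union> ?B \<union> ?C" using comp by blast
    then obtain a where a: "a \<in> X" "b - v - a \<in> Y" using X by auto
    then have "b - v - a - t \<in> X" using Yt by simp
    moreover have "v + a + (b - v - a - t) + t = b" by simp
    ultimately show ?thesis using a(1) by blast
  qed
  \<comment> \<open>The mirror image of \<open>a + (a + t)\<close> is the point \<open>v\<close>
    that \<open>double_in_reflection\<close> requires for the base point \<open>a\<close>.\<close>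
  have dbl: "\<exists>v\<in>X \<union> translate X t. v + 2 * a + t = b" if a: "a \<in> X" for a
  proof (intro bexI)
    have "a + t \<in> Y" using a Yt by simp
    then have "a + (a + t) - a \<in> Y" by simp
    moreover have "a = u \<or> a = u + x \<or> a = u + y" using a X by simp
    ultimately have "a + (a + t) \<in> ?A \<union> ?B \<union> ?C" unfolding Un_iff mem_translate by metis
    then have "b - (a + (a + t)) \<notin> Z" unfolding comp by (simp add: R_def)
    then show "b - (a + (a + t)) \<in> X \<union> translate X t" using nm Yt by blast
    show "b - (a + (a + t)) + 2 * a + t = b" by (simp add: algebra_simps)
  qed
  have "x = 3 * y \<or> y = 3 * x \<or> x = - 2 * y \<or> y = - 2 * x"
  proof -
    obtain v where v: "v \<in> X \<union> translate X t" "v + 2 * u + t = b" using dbl[of u] X by auto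
    show ?thesis by (rule double_in_reflection[OF na p3 _ X v]) (rule sub)
  qed
  moreover have "- x = 3 * (y - x) \<or> y - x = 3 * (- x) \<or> - x = - 2 * (y - x) \<or> y - x = - 2 * (- x)"
  proof -
    have X': "X = {u + x, u + x + - x, u + x + (y - x)}" using X by auto
    obtain v where v: "v \<in> X \<union> translate X t" "v + 2 * (u + x) + t = b" using dbl[of "u + x"] X by auto
    show ?thesis by (rule double_in_reflection[OF not_ap3_rebase(1)[OF na] p3 _ X' v]) (rule sub)
  qed
  moreover have "- y = 3 * (x - y) \<or> x - y = 3 * (- y) \<or> - y = - 2 * (x - y) \<or> x - y = - 2 * (- y)"
  proof -
    have X': "X = {u + y, u + y + - y, u + y + (x - y)}" using X by auto
    obtain v where v: "v \<in> X \<union> translate X t" "v + 2 * (u + y) + t = b" using dbl[of "u + y"] X by auto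
    show ?thesis
      by (rule double_in_reflection[OF not_ap3_rebase(1)[OF not_ap3_rebase(2)[OF na]] p3 _ X' v]) (rule sub)
  qed
  ultimately show False by (rule affine_contradiction[OF p h(1,2)])
qed

section \<open>Existence of a progression among the classes\<close>

lemma ap_class_exists:
  fixes A :: "'p::prime_card mod_ring set"
  assumes fc: "free_coloring b A B C" and p3: "CARD('p) > 3"
    and ord: "2 \<le> card A" "card A \<le> card B" "card B \<le> card C"
  shows "is_ap A \<or> is_ap B \<or> is_ap C"
proof (rule ccontr)
  assume "\<not> ?thesis"
  then have nap: "\<not> is_ap A" "\<not> is_ap B" "\<not> is_ap C" by auto
  have a3: "card A \<ge> 3" using ord(1) nap(1) is_ap_card_2[of A] by fastforce
  have tot: "card A + card B + card C = CARD('p)" by (rule free_coloring_card[OF fc])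
  show False
  proof (cases "card B = 3")
    case True
    \<comment> \<open>All three sizes are at least 3, hence p is at least 9.\<close>
    then show False using no_two_three_classes[OF fc _ _ nap(1,2)] a3 ord tot by simp
  next
    case False
    then have b4: "card B \<ge> 4" using a3 ord by simp
    define T where "T = {w. b - w \<in> C}"
    have "T = translate (uminus ` C) b" by (auto simp: T_def)
    then have cT: "card T = card C" by simp
    have av: "sum_avoids B A T" unfolding sum_avoids_def
    proof (intro ballI notI)
      fix x y assume "x \<in> B" "y \<in> A" "x + y \<in> T"
      then have "y + x + (b - (x + y)) = b" "b - (x + y) \<in> C" by (simp_all add: T_def)
      then show False using fc \<open>x \<in> B\<close> \<open>y \<in> A\<close> unfolding free_coloring_def by blast
    qed
    \<comment> \<open>Seven points outside \<open>B\<close> exist because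
      \<open>card A \<ge> 3\<close> and \<open>card C \<ge> card B \<ge> 4\<close>.\<close>
    obtain e where e: "e \<noteq> 0" "card (steps e B (- B)) \<le> 2"
      using few_components[OF av] cT ord tot b4 a3 by auto
    have fB: "free_coloring b B C A" using fc free_coloring_swap by blast
    have "card (steps e (- B) B) \<noteq> 0" "card (steps e (- B) B) \<noteq> 1" "card (steps e (- B) B) \<le> 2"
      using free_coloring_steps_pos[OF fB e(1)] is_ap_one_component[OF _ e(1)] nap(2) e(2)
        card_steps_compl[of e B] by auto
    then have "card (steps e (- B) B) = 2" by linarith
    then show False
      using no_two_component_class[OF fB e(1) p3] b4 ord a3 nap by auto
  qed
qed

section \<open>The characterization\<close>

lemma rainbow_free_iff_free_coloring:
  assumes "three_coloring A B C"
  shows "rainbow_free A B C b \<longleftrightarrow> free_coloring b A B C"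
proof
  assume rf: "rainbow_free A B C b"
  have "x + y + z \<noteq> b" if "x \<in> A" "y \<in> B" "z \<in> C" for x y z
  proof
    assume "x + y + z = b"
    moreover have "\<not> same_color A B C x y" "\<not> same_color A B C x z" "\<not> same_color A B C y z"
      using assms that unfolding three_coloring_def same_color_def by auto
    ultimately show False using rf unfolding rainbow_free_def rainbow_solution_def by blast
  qed
  then show "free_coloring b A B C" using assms unfolding free_coloring_def by blast
next
  assume fc: "free_coloring b A B C"
  show "rainbow_free A B C b" unfolding rainbow_free_def
  proof
    assume "\<exists>s1 s2 s3. rainbow_solution A B C b s1 s2 s3"
    then obtain x y z where s: "x + y + z = b" "\<not> same_color A B C x y" "\<not> same_color A B C x z"
      "\<not> same_color A B C y z" unfolding rainbow_solution_def by blast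
    have U: "v \<in> A \<or> v \<in> B \<or> v \<in> C" for v using assms unfolding three_coloring_def by blast
    have n: "\<not> (u \<in> A \<and> v \<in> B \<and> w \<in> C)" if "u + v + w = b" for u v w
      using fc that unfolding free_coloring_def by blast
    have "x + z + y = b" "y + x + z = b" "y + z + x = b" "z + x + y = b" "z + y + x = b"
      using s(1) by (simp_all add: algebra_simps)
    then show False using s U[of x] U[of y] U[of z] n unfolding same_color_def
      by (metis insertCI)
  qed
qed

text \<open>Negation of the shifted set is the map from \<open>x\<close> to
  \<open>- x - 2 * h\<close> on \<open>S\<close>; as this is an involution, mapping \<open>S\<close>
  into itself suffices.\<close>

lemma symmetric_set_translate:
  fixes S :: "'p::prime_card mod_ring set"
  shows "symmetric_set (translate S h) \<longleftrightarrow> (\<forall>x\<in>S. - x - 2 * h \<in> S)"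
proof
  assume sym: "symmetric_set (translate S h)"
  show "\<forall>x\<in>S. - x - 2 * h \<in> S"
  proof
    fix x assume "x \<in> S"
    then have "x + h \<in> uminus ` translate S h" using sym unfolding symmetric_set_def by auto
    then show "- x - 2 * h \<in> S" by (simp add: algebra_simps)
  qed
next
  assume r: "\<forall>x\<in>S. - x - 2 * h \<in> S"
  have "- x \<in> translate S h" if "x \<in> translate S h" for x
  proof -
    have eq: "- (x - h) - 2 * h = - x - h" by (simp add: algebra_simps)
    have "x - h \<in> S" using that by simp
    then have "- (x - h) - 2 * h \<in> S" using r by blast
    then show ?thesis unfolding eq by simp
  qed
  then have "x \<in> translate S h \<longleftrightarrow> - x \<in> translate S h" for x by (metis add.inverse_inverse)
  then show "symmetric_set (translate S h)" unfolding symmetric_set_def set_eq_iff mem_uminus_image by blast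
qed

text \<open>The shift makes the reflection send \<open>x\<close> to \<open>b - s - x\<close>, and
  freeness says that it never leads from \<open>B\<close> to \<open>C\<close>. It exchanges
  \<open>s\<close> and \<open>b - 2 * s\<close>, which is why the latter is removed.\<close>

lemma singleton_class:
  fixes b s :: "'p::prime_card mod_ring"
  assumes tc: "three_coloring {s} B C" and p3: "CARD('p) > 3"
  shows "free_coloring b {s} B C \<longleftrightarrow>
    symmetric_set (translate (B - {b - 2 * s}) ((s - b) * inverse 2)) \<and>
    symmetric_set (translate (C - {b - 2 * s}) ((s - b) * inverse 2))"
proof -
  have "(2 :: 'p mod_ring) \<noteq> 0" by (rule mod_ring_2_3_neq_0[OF p3])
  then have h: "- x - 2 * ((s - b) * inverse 2) = b - s - x" for x by simp
  have U: "v = s \<or> v \<in> B \<or> v \<in> C" for v using tc unfolding three_coloring_def by blast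
  have dis: "s \<notin> B" "s \<notin> C" "B \<inter> C = {}" using tc unfolding three_coloring_def by auto
  have free: "free_coloring b {s} B C \<longleftrightarrow> (\<forall>x\<in>B. b - s - x \<notin> C)"
  proof
    assume fc: "free_coloring b {s} B C"
    have "s + x + (b - s - x) = b" for x by simp
    then show "\<forall>x\<in>B. b - s - x \<notin> C" using fc unfolding free_coloring_def by blast
  next
    assume r: "\<forall>x\<in>B. b - s - x \<notin> C"
    have "s + x + z \<noteq> b" if "x \<in> B" "z \<in> C" for x z
    proof
      assume "s + x + z = b"
      then have "z = b - s - x" by (simp add: algebra_simps)
      then show False using r that by blast
    qed
    then show "free_coloring b {s} B C" using tc unfolding free_coloring_def by blast
  qed
  have fix_s: "b - s - x = s \<longleftrightarrow> x = b - 2 * s" "b - s - x = b - 2 * s \<longleftrightarrow> x = s" for x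
    by (rule ring_eq_iff, simp add: algebra_simps)+
  have "(\<forall>x\<in>B. b - s - x \<notin> C) \<longleftrightarrow> (\<forall>x\<in>B - {b - 2 * s}. b - s - x \<in> B - {b - 2 * s}) \<and>
    (\<forall>x\<in>C - {b - 2 * s}. b - s - x \<in> C - {b - 2 * s})" (is "?L \<longleftrightarrow> ?R")
  proof
    assume L: ?L
    then have L': "\<forall>x\<in>C. b - s - x \<notin> B" by (metis add_diff_cancel_left' diff_add_cancel minus_diff_eq uminus_add_conv_diff)
    show ?R using L L' U fix_s dis by (metis DiffE DiffI singletonD singletonI)
  next
    assume R: ?R
    show ?L
    proof (intro ballI notI)
      fix x assume x: "x \<in> B" "b - s - x \<in> C"
      then have "x \<noteq> b - 2 * s" using fix_s(1) dis by metis
      then have "b - s - x \<in> B" using R x by blast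
      then show False using x dis(3) by blast
    qed
  qed
  then show ?thesis unfolding symmetric_set_translate h free .
qed

section \<open>Blocks as cyclic intervals\<close>

lemma cyclic_interval_eq_ap:
  assumes "n < CARD('p)"
  shows "cyclic_interval t (t + of_nat n) = ap 1 (t :: 'p::prime_card mod_ring) n"
proof -
  have "to_int_mod_ring (of_nat n :: 'p mod_ring) = int n"
    using assms by (simp add: of_nat_of_int_mod_ring)
  then show ?thesis by (simp add: cyclic_interval_def ap_def)
qed

lemma dilate_ap: "dilate c (ap d x m) = ap (c * d) (c * x) m"
  unfolding dilate_def ap_def image_image by (rule image_cong) (auto simp: algebra_simps)

text \<open>The lengths add up to p, so the offsets of a rainbow solution satisfy
  \<open>i + j + k \<le> p - 3\<close>, while the condition on \<open>t1 + t2 + t3\<close> makes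
  \<open>i + j + k + 1\<close> or \<open>i + j + k + 2\<close> vanish modulo p.\<close>

lemma free_coloring_of_blocks:
  fixes b d :: "'p::prime_card mod_ring"
  assumes tc: "three_coloring A B C" and d: "d \<noteq> 0"
    and A: "dilate (inverse d) A = cyclic_interval t1 t2"
    and B: "dilate (inverse d) B = cyclic_interval t2 t3"
    and C: "dilate (inverse d) C = cyclic_interval t3 t1"
    and T: "t1 + t2 + t3 \<in> {1 + inverse d * b, 2 + inverse d * b}"
  shows "free_coloring b A B C"
proof -
  \<comment> \<open>Dilation by a nonzero factor preserves cardinality, so the interval length is
    \<open>card S\<close> itself and not only congruent to it.\<close>
  have ci: "\<exists>n<CARD('p). dilate (inverse d) S = ap 1 t n \<and> card S = n"
    if "dilate (inverse d) S = cyclic_interval t u" for S t u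
  proof -
    obtain n where n: "n < CARD('p)" "u - t = of_nat n" using surj_of_nat_mod_ring by blast
    then have "u = t + of_nat n" by (simp add: algebra_simps)
    then have S: "dilate (inverse d) S = ap 1 t n" using that cyclic_interval_eq_ap[OF n(1)] by simp
    have "card (dilate (inverse d) S) = card S"
      unfolding dilate_def by (rule card_image) (use d in \<open>simp add: inj_on_def\<close>)
    then have "card S = n" unfolding S using n(1) by (simp add: card_ap)
    then show ?thesis using S n by blast
  qed
  obtain l m n where l: "dilate (inverse d) A = ap 1 t1 l" "card A = l"
    and m: "dilate (inverse d) B = ap 1 t2 m" "card B = m"
    and n: "dilate (inverse d) C = ap 1 t3 n" "card C = n"
    using ci[OF A] ci[OF B] ci[OF C] by blast
  have sum: "l + m + n = CARD('p)" using three_coloring_card[OF tc] l(2) m(2) n(2) by simp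
  have "x + y + z \<noteq> b" if xyz: "x \<in> A" "y \<in> B" "z \<in> C" for x y z
  proof
    assume eq: "x + y + z = b"
    have "inverse d * x \<in> ap 1 t1 l" "inverse d * y \<in> ap 1 t2 m" "inverse d * z \<in> ap 1 t3 n"
      using xyz l(1) m(1) n(1) unfolding dilate_def by blast+
    then obtain i j k where ijk: "i < l" "j < m" "k < n" "inverse d * x = t1 + of_nat i"
      "inverse d * y = t2 + of_nat j" "inverse d * z = t3 + of_nat k"
      unfolding ap_def by auto
    have "inverse d * b = inverse d * x + inverse d * y + inverse d * z"
      using eq by (simp add: distrib_left[symmetric])
    then have "inverse d * b = t1 + t2 + t3 + of_nat (i + j + k)" unfolding ijk by (simp add: algebra_simps)
    then have "(of_nat (i + j + k + 1) :: 'p mod_ring) = 0 \<or> (of_nat (i + j + k + 2) :: 'p mod_ring) = 0"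
      using T by (auto simp: algebra_simps)
    moreover have "i + j + k + 2 < CARD('p)" using ijk(1-3) sum by linarith
    ultimately show False
      using of_nat_mod_ring_neq_0[of "i + j + k + 1", where 'p='p]
        of_nat_mod_ring_neq_0[of "i + j + k + 2", where 'p='p] by linarith
  qed
  then show ?thesis using tc unfolding free_coloring_def by blast
qed

theorem theorem6:
  fixes p :: nat and b :: "'p::prime_card mod_ring" and A B C :: "'p mod_ring set"
  assumes "prime p" and "p > 3" and "CARD('p) = p"
    and "three_coloring A B C"
    and "1 \<le> card A" and "card A \<le> card B" and "card B \<le> card C"
  shows "rainbow_free A B C b \<longleftrightarrow>
    (\<exists>s. A = {s} \<and>
         symmetric_set (translate (B - {b - 2 * s}) ((s - b) * inverse 2)) \<and>
         symmetric_set (translate (C - {b - 2 * s}) ((s - b) * inverse 2))) \<or>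
    (card A \<ge> 2 \<and>
     (\<exists>d. d \<noteq> 0 \<and>
          arith_progression d A \<and> arith_progression d B \<and> arith_progression d C \<and>
          (\<exists>t1 t2 t3.
             dilate (inverse d) A = cyclic_interval t1 t2 \<and>
             dilate (inverse d) B = cyclic_interval t2 t3 \<and>
             dilate (inverse d) C = cyclic_interval t3 t1 \<and>
             t1 + t2 + t3 \<in> {1 + inverse d * b, 2 + inverse d * b})))"
    (is "_ \<longleftrightarrow> ?i \<or> ?ii")
proof -
  have p3: "CARD('p) > 3" using assms(2,3) by simp
  have rf: "rainbow_free A B C b \<longleftrightarrow> free_coloring b A B C"
    by (rule rainbow_free_iff_free_coloring[OF assms(4)])
  show ?thesis
  proof (cases "card A = 1")
    case True
    then obtain s where s: "A = {s}" by (auto simp: card_1_singleton_iff)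
    show ?thesis unfolding rf using singleton_class[OF assms(4)[unfolded s] p3, of b] s by simp
  next
    case False
    then have A2: "2 \<le> card A" using assms(5) by simp
    have "\<not> ?i" using False by auto
    moreover have "free_coloring b A B C \<longleftrightarrow> ?ii"
    proof
      assume fc: "free_coloring b A B C"
      have big: "2 \<le> card B" "2 \<le> card C" using A2 assms(6,7) by simp_all
      obtain d s t u where d: "d \<noteq> 0"
        and A: "A = ap d s (card A)" and B: "B = ap d t (card B)" and C: "C = ap d u (card C)"
        and t: "t = s + of_nat (card A) * d" and u: "u = t + of_nat (card B) * d"
        and s: "s = u + of_nat (card C) * d" and sum: "s + t + u \<in> {b + d, b + 2 * d}"
        by (rule blocks_of_ap_class[OF fc p3 A2 big ap_class_exists[OF fc p3 A2 assms(6,7)]])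
      have lt: "card A < CARD('p)" "card B < CARD('p)" "card C < CARD('p)"
        using free_coloring_card[OF fc] A2 big by linarith+
      \<comment> \<open>Dividing by \<open>d\<close> gives intervals that chain up, because each
        block begins where the previous one stops.\<close>
      have block: "dilate (inverse d) S = cyclic_interval (inverse d * v) (inverse d * w)"
        if S: "S = ap d v (card S)" "w = v + of_nat (card S) * d" "card S < CARD('p)" for S v w
      proof -
        have "dilate (inverse d) S = ap 1 (inverse d * v) (card S)"
          by (subst S(1)) (simp add: dilate_ap d)
        moreover have "inverse d * w = inverse d * v + of_nat (card S)"
          unfolding S(2) using d by (simp add: distrib_left)
        ultimately show ?thesis using cyclic_interval_eq_ap[OF S(3)] by simp
      qed
      have ap: "arith_progression d S" if "S = ap d v (card S)" for S v
        using that unfolding arith_progression_def ap_def by blast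
      have "inverse d * (b + d) = 1 + inverse d * b" "inverse d * (b + 2 * d) = 2 + inverse d * b"
        using d by (simp_all add: distrib_left)
      then have "inverse d * (s + t + u) \<in> {1 + inverse d * b, 2 + inverse d * b}"
        using sum by (metis insertE insertI1 insertI2 singletonD)
      then have "inverse d * s + inverse d * t + inverse d * u \<in> {1 + inverse d * b, 2 + inverse d * b}"
        by (simp add: distrib_left)
      then show ?ii using A2 d ap[OF A] ap[OF B] ap[OF C] block[OF A t lt(1)] block[OF B u lt(2)]
          block[OF C s lt(3)] by blast
    next
      assume ?ii
      then show "free_coloring b A B C" using free_coloring_of_blocks[OF assms(4)] by blast
    qed
    ultimately show ?thesis using rf by blast
  qed
qed

end
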